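(* Let $X$ be a reflexive Banach space, $Y$ a Banach space, $\mathscr{L}\subset L(X,Y)$ a subset and $\tau$ a locally compact Hausdorff topology on $\mathscr{L}$ that is finer than the strong operator topology, and let $E$, $\|\cdot\|_\infty$ and $E_0=E\cap C_0(\mathscr{L},Y)$ be as defined in the context, where it is assumed that $x\mapsto\hat x$ is injective on $E$ and that $E$ is closed in $C^b(\mathscr{L},Y)$. Assume that $B_{E_0}$ is dense in $B_E$ for the topology generated by the norm $\|\cdot\|_X$ of $X$. Then $E$ is canonically isometric to $E_0^{**}$; that is, the operator $I\colon E_0^{**}\to X$ defined in the context has range exactly $E$, and $I$ is an isometry from $E_0^{**}$ onto $(E,\|\cdot\|_\infty)$.
   Context: $L(X,Y)$ is the space of bounded linear operators from $X$ to $Y$; the strong operator topology on $\mathscr{L}$ is the topology of pointwise norm convergence on $X$. For a locally compact Hausdorff space $L$, $C^b(L,Y)$ is the Banach space of bounded continuous functions $L\to Y$ with norm $\|f\|_\infty=\sup_{t\in L}\|f(t)\|_Y$, and $C_0(L,Y)$ is its closed subspace of those continuous $f$ for which $\{t\in L: \|f(t)\|_Y\ge\varepsilon\}$ is compact for each $\varepsilon>0$. The space $\mathscr{L}$ always carries the topology $\tau$. For $x\in X$ let $\hat x\colon\mathscr{L}\to Y$, $\hat x(T)=Tx$, which is continuous on $(\mathscr{L},\tau)$. Define the vector subspace $E=\{x\in X: \sup_{T\in\mathscr{L}}\|Tx\|_Y<\infty\}$ of $X$. It is assumed that $x\mapsto\hat x$ is injective, so that $\|x\|_\infty:=\sup_{T\in\mathscr{L}}\|Tx\|_Y$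 is a norm on $E$, and $E$ is identified isometrically with the subspace $\{\hat x: x\in E\}$ of $C^b(\mathscr{L},Y)$. It is further assumed that $E$ is closed in $C^b(\mathscr{L},Y)$. Put $E_0=E\cap C_0(\mathscr{L},Y)=\{x\in E:\hat x\in C_0(\mathscr{L},Y)\}$, also with norm $\|\cdot\|_\infty$. Under these assumptions $E$ and $E_0$ are Banach spaces and the inclusion $(E,\|\cdot\|_\infty)\to(X,\|\cdot\|_X)$ is continuous. $B_E$ and $B_{E_0}$ denote the closed unit balls with respect to $\|\cdot\|_\infty$. Let $i_0\colon E_0\to X$, $i_0(x)=x$; let $J=i_0^*\colon X^*\to E_0^*$, so $Jx^*=x^*|_{E_0}$; and let $I=J^*\colon E_0^{**}\to X^{**}=X$ (using reflexivity of $X$). Then $I\circ\beta_{E_0}$ is the inclusion of $E_0$ into $E$, where $\beta_{E_0}\colon E_0\to E_0^{**}$ is the canonical embedding. *)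

theory Defs
  imports "HOL-Analysis.Analysis" "HOL-Library.Function_Algebras"
begin

section \<open>Scalars\<close>

text \<open>
  Banach spaces are over the real or the complex field. The library class \<open>banach\<close> only provides
  the real scalar multiplication, so the scalar field is a type \<open>'k\<close> that is
  (a copy of) the reals or the complex numbers with the usual absolute value, and its action is an
  explicit function extending the real one.
\<close>

class real_or_complex_field = real_normed_field +
  assumes real_or_complex:
    "(\<forall>z. \<exists>a. z = a *\<^sub>R 1) \<or>
     (\<exists>j. j * j = - 1 \<and> (\<forall>z. \<exists>a b. z = a *\<^sub>R 1 + b *\<^sub>R j) \<and>
          (\<forall>a b. norm (a *\<^sub>R 1 + b *\<^sub>R j) = sqrt (a\<^sup>2 + b\<^sup>2)))"

instance real :: real_or_complex_field
  by standard auto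

instance complex :: real_or_complex_field
proof
  have "\<exists>a b. z = a *\<^sub>R 1 + b *\<^sub>R \<i>" for z :: complex
    by (intro exI[of _ "Re z"] exI[of _ "Im z"]) (simp add: complex_eq_iff)
  moreover have "norm (a *\<^sub>R 1 + b *\<^sub>R \<i>) = sqrt (a\<^sup>2 + b\<^sup>2)" for a b
    by (simp add: cmod_def)
  ultimately show "(\<forall>z::complex. \<exists>a. z = a *\<^sub>R 1) \<or>
     (\<exists>j::complex. j * j = - 1 \<and> (\<forall>z. \<exists>a b. z = a *\<^sub>R 1 + b *\<^sub>R j) \<and>
          (\<forall>a b. norm (a *\<^sub>R 1 + b *\<^sub>R j) = sqrt (a\<^sup>2 + b\<^sup>2)))"
    by (intro disjI2 exI[of _ \<i>]) simp
qed

locale normed_scaling = vector_space scale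
  for scale :: "'k::real_or_complex_field \<Rightarrow> 'v::real_normed_vector \<Rightarrow> 'v" +
  assumes scale_of_real: "scale (of_real r) x = r *\<^sub>R x"
    and norm_scale: "norm (scale c x) = norm c * norm x"

lemma normed_scaling_scaleR: "normed_scaling (scaleR :: real \<Rightarrow> 'v::real_normed_vector \<Rightarrow> 'v)"
  by unfold_locales (simp_all add: algebra_simps)

lemma normed_scaling_complex: "normed_scaling ((*) :: complex \<Rightarrow> complex \<Rightarrow> complex)"
  by unfold_locales (simp_all add: algebra_simps norm_mult scaleR_conv_of_real)

section \<open>Duals, adjoints and isometries for normed subspaces\<close>

text \<open>
  A normed space is given by a scaling \<open>s\<close>, a carrier \<open>V\<close> and a norm \<open>N\<close> on \<open>V\<close>, which need not be
  the norm of the ambient type. Functionals on \<open>V\<close> are extended by \<open>0\<close> outside \<open>V\<close>,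
  so that they are determined by their values on \<open>V\<close> and the dual
  is closed under the pointwise operations.
\<close>

definition unit_ball :: "'v set \<Rightarrow> ('v \<Rightarrow> real) \<Rightarrow> 'v set" where
  "unit_ball V N = {x \<in> V. N x \<le> 1}"

definition dual ::
  "('k::real_or_complex_field \<Rightarrow> 'v::ab_group_add \<Rightarrow> 'v) \<Rightarrow> 'v set \<Rightarrow> ('v \<Rightarrow> real) \<Rightarrow> ('v \<Rightarrow> 'k) set"
where
  "dual s V N = {f. (\<forall>x\<in>V. \<forall>y\<in>V. f (x + y) = f x + f y) \<and>
                    (\<forall>c. \<forall>x\<in>V. f (s c x) = c * f x) \<and>
                    (\<exists>C. \<forall>x\<in>V. norm (f x) \<le> C * N x) \<and>
                    (\<forall>x. x \<notin> V \<longrightarrow> f x = 0)}"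

definition dual_norm :: "'v set \<Rightarrow> ('v \<Rightarrow> real) \<Rightarrow> ('v \<Rightarrow> 'k::real_or_complex_field) \<Rightarrow> real" where
  "dual_norm V N f = (SUP x\<in>unit_ball V N. norm (f x))"

definition fun_scale :: "'k::times \<Rightarrow> ('a \<Rightarrow> 'k) \<Rightarrow> 'a \<Rightarrow> 'k" where
  "fun_scale c f = (\<lambda>x. c * f x)"

definition bidual ::
  "('k::real_or_complex_field \<Rightarrow> 'v::ab_group_add \<Rightarrow> 'v) \<Rightarrow> 'v set \<Rightarrow> ('v \<Rightarrow> real) \<Rightarrow>
   (('v \<Rightarrow> 'k) \<Rightarrow> 'k) set"
where
  "bidual s V N = dual fun_scale (dual s V N) (dual_norm V N)"

definition bidual_norm ::
  "('k::real_or_complex_field \<Rightarrow> 'v::ab_group_add \<Rightarrow> 'v) \<Rightarrow> 'v set \<Rightarrow> ('v \<Rightarrow> real) \<Rightarrow>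
   (('v \<Rightarrow> 'k) \<Rightarrow> 'k) \<Rightarrow> real"
where
  "bidual_norm s V N = dual_norm (dual s V N) (dual_norm V N)"

definition canonical_embedding ::
  "('k::real_or_complex_field \<Rightarrow> 'v::ab_group_add \<Rightarrow> 'v) \<Rightarrow> 'v set \<Rightarrow> ('v \<Rightarrow> real) \<Rightarrow>
   'v \<Rightarrow> ('v \<Rightarrow> 'k) \<Rightarrow> 'k"
where
  "canonical_embedding s V N x = (\<lambda>f. if f \<in> dual s V N then f x else 0)"

definition reflexive ::
  "('k::real_or_complex_field \<Rightarrow> 'v::ab_group_add \<Rightarrow> 'v) \<Rightarrow> 'v set \<Rightarrow> ('v \<Rightarrow> real) \<Rightarrow> bool"
where
  "reflexive s V N \<longleftrightarrow> canonical_embedding s V N ` V = bidual s V N"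

text \<open>The adjoint of an operator \<open>A\<close> with domain \<open>V\<close>.\<close>

definition adjoint_on :: "'v set \<Rightarrow> ('v \<Rightarrow> 'w) \<Rightarrow> ('w \<Rightarrow> 'k::zero) \<Rightarrow> 'v \<Rightarrow> 'k" where
  "adjoint_on V A g = (\<lambda>x. if x \<in> V then g (A x) else 0)"

definition linear_isometry_onto ::
  "('k \<Rightarrow> 'v::ab_group_add \<Rightarrow> 'v) \<Rightarrow> 'v set \<Rightarrow> ('v \<Rightarrow> real) \<Rightarrow>
   ('k \<Rightarrow> 'w::ab_group_add \<Rightarrow> 'w) \<Rightarrow> 'w set \<Rightarrow> ('w \<Rightarrow> real) \<Rightarrow> ('v \<Rightarrow> 'w) \<Rightarrow> bool"
where
  "linear_isometry_onto s V N t W M f \<longleftrightarrow>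
     (\<forall>x\<in>V. \<forall>y\<in>V. f (x + y) = f x + f y) \<and>
     (\<forall>c. \<forall>x\<in>V. f (s c x) = t c (f x)) \<and>
     (\<forall>x\<in>V. M (f x) = N x) \<and>
     f ` V = W"

section \<open>The spaces $E$ and $E_0$ and the operator $I$\<close>

text \<open>A bounded operator of type \<open>'x \<Rightarrow>\<^sub>L 'y\<close> is only real-linear.\<close>

definition bounded_operators ::
  "('k \<Rightarrow> 'x::real_normed_vector \<Rightarrow> 'x) \<Rightarrow> ('k \<Rightarrow> 'y::real_normed_vector \<Rightarrow> 'y) \<Rightarrow> ('x \<Rightarrow>\<^sub>L 'y) set"
where
  "bounded_operators sX sY = {T. \<forall>c x. blinfun_apply T (sX c x) = sY c (blinfun_apply T x)}"

definition finer_than :: "'a topology \<Rightarrow> 'a topology \<Rightarrow> bool" where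
  "finer_than \<tau> \<sigma> \<longleftrightarrow> topspace \<tau> = topspace \<sigma> \<and> (\<forall>U. openin \<sigma> U \<longrightarrow> openin \<tau> U)"

text \<open>
  The space of bounded continuous functions is the library's metric space
  \<^term>\<open>cfunspace \<tau> euclidean_metric\<close>: its elements are extensional on \<^term>\<open>topspace \<tau>\<close> and its
  metric is the supremum metric.
\<close>

definition C0 :: "'a topology \<Rightarrow> ('a \<Rightarrow> 'y::real_normed_vector) set" where
  "C0 \<tau> = {f \<in> mspace (cfunspace \<tau> euclidean_metric).
             \<forall>\<epsilon>>0. compactin \<tau> {t \<in> topspace \<tau>. norm (f t) \<ge> \<epsilon>}}"

definition evaluation ::
  "('x::real_normed_vector \<Rightarrow>\<^sub>L 'y::real_normed_vector) set \<Rightarrow> 'x \<Rightarrow> ('x \<Rightarrow>\<^sub>L 'y) \<Rightarrow> 'y"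
where
  "evaluation L x = (\<lambda>T\<in>L. blinfun_apply T x)"

definition E_space :: "('x::real_normed_vector \<Rightarrow>\<^sub>L 'y::real_normed_vector) set \<Rightarrow> 'x set" where
  "E_space L = {x. bdd_above ((\<lambda>T. norm (blinfun_apply T x)) ` L)}"

text \<open>The supremum is taken in \<open>[0,\<infinity>]\<close>, so it is \<open>0\<close> for empty \<open>L\<close>.\<close>

definition E_norm :: "('x::real_normed_vector \<Rightarrow>\<^sub>L 'y::real_normed_vector) set \<Rightarrow> 'x \<Rightarrow> real" where
  "E_norm L x = (if L = {} then 0 else SUP T\<in>L. norm (blinfun_apply T x))"

definition E0_space ::
  "('x::real_normed_vector \<Rightarrow>\<^sub>L 'y::real_normed_vector) set \<Rightarrow> ('x \<Rightarrow>\<^sub>L 'y) topology \<Rightarrow> 'x set"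
where
  "E0_space L \<tau> = {x \<in> E_space L. evaluation L x \<in> C0 \<tau>}"

definition J_op ::
  "('x::real_normed_vector \<Rightarrow>\<^sub>L 'y::real_normed_vector) set \<Rightarrow> ('x \<Rightarrow>\<^sub>L 'y) topology \<Rightarrow>
   ('x \<Rightarrow> 'k::real_or_complex_field) \<Rightarrow> 'x \<Rightarrow> 'k"
where
  "J_op L \<tau> = adjoint_on (E0_space L \<tau>) (\<lambda>x. x)"

text \<open>The adjoint of \<open>J_op\<close>, followed by the identification of the bidual of a reflexive \<open>X\<close> with \<open>X\<close>
  through the (injective) canonical embedding.\<close>

definition I_op ::
  "('k::real_or_complex_field \<Rightarrow> 'x::real_normed_vector \<Rightarrow> 'x) \<Rightarrow>
   ('x \<Rightarrow>\<^sub>L 'y::real_normed_vector) set \<Rightarrow> ('x \<Rightarrow>\<^sub>L 'y) topology \<Rightarrow> (('x \<Rightarrow> 'k) \<Rightarrow> 'k) \<Rightarrow> 'x"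
where
  "I_op sX L \<tau> \<Phi> =
     inv_into UNIV (canonical_embedding sX UNIV norm)
       (adjoint_on (dual sX UNIV norm) (J_op L \<tau>) \<Phi>)"

end

theory Submission
  imports Defs
begin

text \<open>
  Write \<open>J\<close> for the restriction map from \<open>X\<^sup>*\<close> to the dual of \<open>E\<^sub>0\<close> and \<open>I\<close> for its adjoint. Reflexivity of
  \<open>X\<close> turns the defining property of \<open>I\<close> into the identity \<open>f (I \<Phi>) = \<Phi> (J f)\<close> for all \<open>f\<close> in \<open>X\<^sup>*\<close>
  (\<open>I_op_apply\<close>), and the theorem follows from three consequences of it.

  \<^item> \<open>I\<close> is a contraction into \<open>E\<close> (\<open>I_op_bound\<close>). For an operator \<open>T\<close> of the family and a functional
    \<open>g\<close> of norm at most one on \<open>Y\<close>, the functional \<open>g \<circ> T\<close> has norm at most one on \<open>E\<^sub>0\<close>, because the norm of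
    \<open>E\<^sub>0\<close> is the supremum of \<open>norm (T x)\<close> over \<open>T\<close>. Hence \<open>g (T (I \<Phi>)) = \<Phi> (J (g \<circ> T))\<close> is at most
    the norm of \<open>\<Phi>\<close>, and \<open>g\<close> can be chosen norming.

  \<^item> Every \<open>x\<close> in \<open>E\<close> is \<open>I \<Phi>\<close> for some \<open>\<Phi>\<close> of norm at most that of \<open>x\<close> (\<open>exists_bidual_preimage\<close>).
    The density hypothesis gives \<open>u n\<close> in \<open>E\<^sub>0\<close> with norms bounded by that of \<open>x\<close> and converging to \<open>x\<close>
    in \<open>X\<close>, and \<open>\<Phi> \<phi>\<close> is the limit of \<open>\<phi> (u n)\<close>. The limit exists for \<open>\<phi> = J f\<close>, therefore for all
    \<open>\<phi>\<close> in the closure of the range of \<open>J\<close>.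

  \<^item> \<open>I\<close> is injective (\<open>I_op_inj\<close>), since \<open>J\<close> has dense range.

  An isometry results: the preimage of \<open>I \<Phi>\<close> given by the second item has norm at most that of
  \<open>I \<Phi>\<close>, and by injectivity it is \<open>\<Phi>\<close>.

  Everything thus rests on the density of the range of \<open>J\<close> (\<open>J_op_dense_range\<close>). The classical
  argument represents a functional on \<open>C\<^sub>0(L,Y)\<close> by a vector measure and restricts the measure to a
  large compact set. Here the measure is replaced by the following remark
  (\<open>functional_concentrated_on_compact\<close>). Extend the functional to \<open>\<psi>\<close> on \<open>C\<^sub>0(L,Y)\<close> by Hahn-Banach
  and choose \<open>f\<close> in the unit ball at which \<open>\<psi>\<close> almost attains its norm. Off the compact set where \<open>f\<close>
  is not small there is room to add any function of the unit ball to \<open>f\<close> without increasing the norm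
  noticeably, so \<open>\<psi>\<close> is almost zero on functions living there. Cutting off to the compact set changes
  \<open>\<psi>\<close> little, and on a compact set of operators the uniform boundedness principle bounds the cut
  functional by the norm of \<open>X\<close>.

  The uniform boundedness principle and the closed graph theorem for the inclusion of \<open>E\<close> in \<open>X\<close>
  are both instances of Zabreiko's lemma (\<open>countably_subadditive_imp_bounded\<close>).
\<close>

section \<open>The Hahn-Banach theorem for seminorms\<close>

definition sublinear_on :: "('k::real_or_complex_field \<Rightarrow> 'v::ab_group_add \<Rightarrow> 'v) \<Rightarrow> 'v set \<Rightarrow> ('v \<Rightarrow> real) \<Rightarrow> bool"
  where "sublinear_on s V q \<longleftrightarrow>
    (\<forall>x\<in>V. \<forall>y\<in>V. q (x + y) \<le> q x + q y) \<and> (\<forall>t\<ge>0. \<forall>x\<in>V. q (s (of_real t) x) = t * q x)"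

text \<open>
  The spaces of interest are subspaces of larger types: \<open>E\<close> inside \<open>X\<close>, the functions vanishing at
  infinity inside all functions, and dual spaces inside all scalar functions. The
  norms of these subspaces are not those of the ambient types.
\<close>

locale carrier_space = vector_space s
  for s :: "'k::real_or_complex_field \<Rightarrow> 'v::ab_group_add \<Rightarrow> 'v" +
  fixes V :: "'v set"
  assumes subspace_V: "subspace V"
begin

lemma zero_V [simp]: "0 \<in> V"
  and add_V [intro]: "x \<in> V \<Longrightarrow> y \<in> V \<Longrightarrow> x + y \<in> V"
  and scale_V [intro]: "x \<in> V \<Longrightarrow> s c x \<in> V"
  and uminus_V [intro]: "x \<in> V \<Longrightarrow> - x \<in> V"
  and diff_V [intro]: "x \<in> V \<Longrightarrow> y \<in> V \<Longrightarrow> x - y \<in> V"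
  using subspace_V by (auto simp: subspace_0 subspace_add subspace_scale subspace_neg subspace_diff)

lemma sublinear_onI:
  assumes add: "\<And>x y. x \<in> V \<Longrightarrow> y \<in> V \<Longrightarrow> q (x + y) \<le> q x + q y"
    and zero: "q 0 = 0"
    and scale: "\<And>t x. t > 0 \<Longrightarrow> x \<in> V \<Longrightarrow> q (s (of_real t) x) \<le> t * q x"
  shows "sublinear_on s V q"
  unfolding sublinear_on_def
proof (intro conjI ballI allI impI)
  fix t :: real and x assume t: "t \<ge> 0" and x: "x \<in> V"
  show "q (s (of_real t) x) = t * q x"
  proof (cases "t = 0")
    case False
    with t have t: "t > 0" by simp
    have "q x = q (s (of_real (1/t)) (s (of_real t) x))"
      using t by (simp flip: of_real_mult)
    also have "\<dots> \<le> (1/t) * q (s (of_real t) x)"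
      using t x by (intro scale) auto
    finally have "t * q x \<le> q (s (of_real t) x)"
      using t by (simp add: field_simps)
    with scale[OF t x] show ?thesis by simp
  qed (simp add: zero)
qed (rule add)

lemma sublinear_zero: "sublinear_on s V q \<Longrightarrow> q 0 = 0"
  unfolding sublinear_on_def by (metis mult_zero_left of_real_0 order_refl scale_zero_left zero_V)

lemma sublinear_uminus:
  assumes "sublinear_on s V q" "x \<in> V" shows "- q (- x) \<le> q x"
proof -
  have "q (x + - x) \<le> q x + q (- x)"
    using assms unfolding sublinear_on_def by (metis uminus_V)
  with sublinear_zero[OF assms(1)] show ?thesis by simp
qed

text \<open>
  The infimal convolution \<open>x \<mapsto> INF k\<in>K. q (x - k) + g k\<close> is the largest sublinear functional
  below both \<open>q\<close> and \<open>g\<close>; the condition relating \<open>q\<close> and \<open>g\<close> keeps the infimum finite. It serves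
  twice in the Hahn-Banach theorem: with a linear functional on a subspace as \<open>g\<close> it encodes what is
  to be extended, and with \<open>K\<close> a ray it shows that minimal sublinear functionals are odd.
\<close>

lemma sublinear_below_cone:
  assumes q: "sublinear_on s V q"
    and K: "K \<subseteq> V" "0 \<in> K" "\<And>k l. k \<in> K \<Longrightarrow> l \<in> K \<Longrightarrow> k + l \<in> K"
      "\<And>t k. t > 0 \<Longrightarrow> k \<in> K \<Longrightarrow> s (of_real t) k \<in> K"
    and g: "\<And>k l. k \<in> K \<Longrightarrow> l \<in> K \<Longrightarrow> g (k + l) \<le> g k + g l" "g 0 = 0"
      "\<And>t k. t > 0 \<Longrightarrow> k \<in> K \<Longrightarrow> g (s (of_real t) k) = t * g k"
    and qg: "\<And>k. k \<in> K \<Longrightarrow> - q (- k) \<le> g k"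
  shows "\<exists>q'. sublinear_on s V q' \<and> (\<forall>x\<in>V. q' x \<le> q x) \<and> (\<forall>k\<in>K. q' k \<le> g k)"
proof -
  note qadd = q[unfolded sublinear_on_def, THEN conjunct1, rule_format]
  note qscale = q[unfolded sublinear_on_def, THEN conjunct2, rule_format]
  define q' where "q' x = (INF k\<in>K. q (x - k) + g k)" for x
  have bound: "- q (- x) \<le> q (x - k) + g k" if "x \<in> V" "k \<in> K" for x k
  proof -
    have "q ((x - k) + (- x)) \<le> q (x - k) + q (- x)"
      using that K(1) by (intro qadd) auto
    then have "q (- k) \<le> q (x - k) + q (- x)"
      by simp
    with qg[OF that(2)] show ?thesis by linarith
  qed
  then have bdd: "bdd_below ((\<lambda>k. q (x - k) + g k) ` K)" if "x \<in> V" for x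
    using that by (meson bdd_below.I2)
  have upper: "q' x \<le> q (x - k) + g k" if "x \<in> V" "k \<in> K" for x k
    unfolding q'_def using that bdd by (intro cINF_lower)
  have lower: "c \<le> q' x" if "\<And>k. k \<in> K \<Longrightarrow> c \<le> q (x - k) + g k" for c x
    unfolding q'_def using that K(2) by (intro cINF_greatest) auto
  have q'0: "q' 0 = 0"
    using upper[of 0 0] lower[of 0 0] bound[of 0] g(2) K(2) sublinear_zero[OF q]
    by (intro antisym) auto
  have q'add: "q' (x + y) \<le> q' x + q' y" if "x \<in> V" "y \<in> V" for x y
  proof -
    have "q' (x + y) \<le> (q (x - k) + g k) + (q (y - l) + g l)" if "k \<in> K" "l \<in> K" for k l
    proof -
      have "q' (x + y) \<le> q ((x + y) - (k + l)) + g (k + l)"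
        using that \<open>x \<in> V\<close> \<open>y \<in> V\<close> K by (intro upper) auto
      also have "(x + y) - (k + l) = (x - k) + (y - l)" by simp
      also have "q ((x - k) + (y - l)) \<le> q (x - k) + q (y - l)"
        using that \<open>x \<in> V\<close> \<open>y \<in> V\<close> K(1) by (intro qadd) auto
      finally show ?thesis using g(1)[OF that] by linarith
    qed
    then have "q' (x + y) - (q (x - k) + g k) \<le> q (y - l) + g l" if "k \<in> K" "l \<in> K" for k l
      using that by fastforce
    then have "q' (x + y) - (q (x - k) + g k) \<le> q' y" if "k \<in> K" for k
      using that by (intro lower)
    then have "q' (x + y) - q' y \<le> q' x"
      by (intro lower) (smt (verit))
    then show ?thesis by simp
  qed
  have q'scale: "q' (s (of_real t) x) \<le> t * q' x" if "t > 0" "x \<in> V" for t x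
  proof -
    have "q' (s (of_real t) x) / t \<le> q (x - k) + g k" if "k \<in> K" for k
    proof -
      have "q' (s (of_real t) x) \<le> q (s (of_real t) x - s (of_real t) k) + g (s (of_real t) k)"
        using that \<open>x \<in> V\<close> \<open>t > 0\<close> K by (intro upper) auto
      also have "\<dots> = t * (q (x - k) + g k)"
        using that \<open>t > 0\<close> \<open>x \<in> V\<close> K(1)
        by (subst scale_right_diff_distrib[symmetric], subst qscale)
          (auto simp: g(3) algebra_simps)
      finally show ?thesis using \<open>t > 0\<close> by (simp add: field_simps)
    qed
    then have "q' (s (of_real t) x) / t \<le> q' x" by (rule lower)
    then show ?thesis using \<open>t > 0\<close> by (simp add: field_simps)
  qed
  have "sublinear_on s V q'"
    by (rule sublinear_onI) (use q'add q'0 q'scale in auto)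
  moreover have "q' x \<le> q x" if "x \<in> V" for x
    using upper[OF that K(2)] g(2) by simp
  moreover have "q' k \<le> g k" if "k \<in> K" for k
    using upper[of k k] that K(1) sublinear_zero[OF q] by auto
  ultimately show ?thesis by blast
qed

text \<open>
  Zorn's lemma applies since the pointwise infimum of a chain of sublinear functionals below \<open>p\<close> is
  sublinear, being bounded below by \<open>- p (- x)\<close>. Functionals are set to \<open>0\<close> outside \<open>V\<close> so that the
  pointwise order is antisymmetric.
\<close>

lemma exists_minimal_sublinear:
  assumes p: "sublinear_on s V p"
  shows "\<exists>q. sublinear_on s V q \<and> (\<forall>x\<in>V. q x \<le> p x) \<and>
    (\<forall>r. sublinear_on s V r \<and> (\<forall>x\<in>V. r x \<le> q x) \<longrightarrow> (\<forall>x\<in>V. r x = q x))"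
proof -
  define S where "S = {q. sublinear_on s V q \<and> (\<forall>x\<in>V. q x \<le> p x) \<and> (\<forall>x. x \<notin> V \<longrightarrow> q x = 0)}"
  have cut: "sublinear_on s V (\<lambda>x. if x \<in> V then r x else 0)" if "sublinear_on s V r" for r
    using that by (auto simp: sublinear_on_def)
  have "\<exists>m\<in>S. \<forall>a\<in>S. a \<le> m \<longrightarrow> a = m"
  proof (rule predicate_Zorn)
    show "partial_order_on S (relation_of (\<lambda>a b. b \<le> a) S)"
      by (rule partial_order_on_relation_ofI) auto
  next
    fix C assume C: "C \<in> Chains (relation_of (\<lambda>a b. b \<le> a) S)"
    then have CS: "C \<subseteq> S" and chain: "\<And>a b. a \<in> C \<Longrightarrow> b \<in> C \<Longrightarrow> b \<le> a \<or> a \<le> b"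
      by (auto simp: Chains_def relation_of_def)
    show "\<exists>u\<in>S. \<forall>a\<in>C. u \<le> a"
    proof (cases "C = {}")
      case True
      then show ?thesis using cut[OF p] by (auto simp: S_def)
    next
      case False
      define u where "u x = (if x \<in> V then INF q\<in>C. q x else 0)" for x
      have qadd: "q (x + y) \<le> q x + q y" if "q \<in> C" "x \<in> V" "y \<in> V" for q x y
        using that CS by (auto simp: S_def sublinear_on_def)
      have qscale: "q (s (of_real t) x) = t * q x" if "q \<in> C" "x \<in> V" "t \<ge> 0" for q x t
        using that CS by (auto simp: S_def sublinear_on_def)
      have lb: "- p (- x) \<le> q x" if "q \<in> C" "x \<in> V" for q x
      proof -
        have "- q (- x) \<le> q x" using that CS sublinear_uminus by (auto simp: S_def)
        moreover have "q (- x) \<le> p (- x)" using that CS by (auto simp: S_def)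
        ultimately show ?thesis by linarith
      qed
      have upper: "u x \<le> q x" if "q \<in> C" "x \<in> V" for q x
        using that lb by (auto simp: u_def intro!: cINF_lower bdd_belowI2[where m = "- p (- x)"])
      have lower: "c \<le> u x" if "x \<in> V" "\<And>q. q \<in> C \<Longrightarrow> c \<le> q x" for c x
        using that False by (auto simp: u_def intro!: cINF_greatest)
      have u0: "u 0 = 0"
      proof -
        have q0: "q 0 = 0" if "q \<in> C" for q
          using that CS sublinear_zero by (auto simp: S_def)
        obtain q where "q \<in> C" using False by blast
        then have "u 0 \<le> 0" using upper[OF _ zero_V] q0 by metis
        moreover have "0 \<le> u 0" using lower[OF zero_V] q0 by (metis order_refl)
        ultimately show ?thesis by simp
      qed
      have uadd: "u (x + y) \<le> u x + u y" if xy: "x \<in> V" "y \<in> V" for x y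
      proof -
        have *: "u (x + y) \<le> q x + r y" if qr: "q \<in> C" "r \<in> C" for q r
        proof -
          from chain[OF qr] obtain w where w: "w \<in> C" "w \<le> q" "w \<le> r"
            using qr by auto
          have "u (x + y) \<le> w (x + y)" using w xy by (intro upper) auto
          also have "\<dots> \<le> w x + w y" using w xy by (intro qadd)
          also have "\<dots> \<le> q x + r y" using w by (intro add_mono) (auto simp: le_fun_def)
          finally show ?thesis .
        qed
        have "u (x + y) - q x \<le> u y" if "q \<in> C" for q
          using *[OF that] xy by (intro lower) (auto simp: algebra_simps)
        then have "u (x + y) - u y \<le> u x"
          using xy by (intro lower) (auto simp: algebra_simps)
        then show ?thesis by simp
      qed
      have uscale: "u (s (of_real t) x) \<le> t * u x" if "t > 0" "x \<in> V" for t x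
      proof -
        have "u (s (of_real t) x) / t \<le> u x"
          using that upper[of _ "s (of_real t) x"]
          by (intro lower) (auto simp: qscale field_simps)
        then show ?thesis using that by (simp add: field_simps)
      qed
      have "sublinear_on s V u"
        by (rule sublinear_onI) (use uadd u0 uscale in auto)
      moreover have "u x \<le> p x" if "x \<in> V" for x
        using False upper[OF _ that] CS that by (fastforce simp: S_def)
      ultimately have "u \<in> S" by (simp add: S_def u_def)
      moreover have "u \<le> a" if "a \<in> C" for a
      proof (rule le_funI)
        fix x show "u x \<le> a x"
          using upper[OF that, of x] that CS by (cases "x \<in> V") (auto simp: S_def u_def)
      qed
      ultimately show ?thesis by blast
    qed
  qed
  then obtain q where q: "q \<in> S" and min: "\<And>a. a \<in> S \<Longrightarrow> a \<le> q \<Longrightarrow> a = q"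
    by blast
  have "\<forall>x\<in>V. r x = q x" if r: "sublinear_on s V r" "\<forall>x\<in>V. r x \<le> q x" for r
  proof -
    have "(\<lambda>x. if x \<in> V then r x else 0) \<in> S"
      using q r cut[OF r(1)] by (auto simp: S_def intro: order_trans)
    moreover have "(\<lambda>x. if x \<in> V then r x else 0) \<le> q"
      using q r by (auto simp: S_def le_fun_def)
    ultimately have "(\<lambda>x. if x \<in> V then r x else 0) = q" by (rule min)
    then show ?thesis by (metis (mono_tags, lifting))
  qed
  then show ?thesis using q by (auto simp: S_def)
qed

text \<open>
  On the ray spanned by \<open>- a\<close> the function \<open>k \<mapsto> - q (- k)\<close> is additive, so there is a sublinear
  functional below \<open>q\<close> whose value at \<open>- a\<close> is at most \<open>- q a\<close>. By minimality it equals \<open>q\<close>.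
\<close>

lemma minimal_sublinear_odd:
  assumes q: "sublinear_on s V q"
    and min: "\<And>r. sublinear_on s V r \<Longrightarrow> \<forall>x\<in>V. r x \<le> q x \<Longrightarrow> \<forall>x\<in>V. r x = q x"
    and a: "a \<in> V"
  shows "q (- a) = - q a"
proof -
  note qscale = q[unfolded sublinear_on_def, THEN conjunct2, rule_format]
  define K where "K = (\<lambda>t. - s (of_real t) a) ` {0..}"
  have g: "- q (- (- s (of_real t) a)) = - t * q a" if "t \<ge> 0" for t
    using that a by (simp add: qscale)
  have "\<exists>q'. sublinear_on s V q' \<and> (\<forall>x\<in>V. q' x \<le> q x) \<and> (\<forall>k\<in>K. q' k \<le> - q (- k))"
  proof (rule sublinear_below_cone[OF q])
    show "K \<subseteq> V" "0 \<in> K" using a by (auto simp: K_def image_iff intro: bexI[of _ 0])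
    show "k + l \<in> K" if "k \<in> K" "l \<in> K" for k l
    proof -
      from that obtain t r where "t \<ge> 0" "r \<ge> 0" "k = - s (of_real t) a" "l = - s (of_real r) a"
        by (auto simp: K_def)
      then have "k + l = - s (of_real (t + r)) a" "t + r \<ge> 0"
        by (auto simp: scale_left_distrib)
      then show ?thesis unfolding K_def by (metis atLeast_iff imageI)
    qed
    show "s (of_real t) k \<in> K" if "t > 0" "k \<in> K" for t k
    proof -
      from that obtain r where "r \<ge> 0" "k = - s (of_real r) a" by (auto simp: K_def)
      with that have "s (of_real t) k = - s (of_real (t * r)) a" "t * r \<ge> 0"
        by auto
      then show ?thesis unfolding K_def by (metis atLeast_iff imageI)
    qed
    show "- q (- (k + l)) \<le> - q (- k) + - q (- l)" if "k \<in> K" "l \<in> K" for k l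
    proof -
      from that obtain t r where tr: "t \<ge> 0" "r \<ge> 0" "k = - s (of_real t) a" "l = - s (of_real r) a"
        by (auto simp: K_def)
      then have "k + l = - s (of_real (t + r)) a" by (simp add: scale_left_distrib)
      then have "- q (- (k + l)) = - (t + r) * q a" using g[of "t + r"] tr by simp
      then show ?thesis using g[of t] g[of r] tr by (simp add: algebra_simps)
    qed
    show "- q (- 0) = 0" using sublinear_zero[OF q] by simp
    show "- q (- s (of_real t) k) = t * - q (- k)" if "t > 0" "k \<in> K" for t k
    proof -
      have "- k \<in> V" using that a by (auto simp: K_def)
      then have "q (s (of_real t) (- k)) = t * q (- k)" using that by (intro qscale) auto
      then show ?thesis by simp
    qed
  qed simp
  then obtain q' where q': "sublinear_on s V q'" "\<forall>x\<in>V. q' x \<le> q x" "\<forall>k\<in>K. q' k \<le> - q (- k)"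
    by blast
  have "- a \<in> K" unfolding K_def by (rule image_eqI[of _ _ 1]) auto
  then have "q' (- a) \<le> - q a" using q'(3) by fastforce
  moreover have "q' (- a) = q (- a)" using min[OF q'(1,2)] a by auto
  moreover have "- q a \<le> q (- a)" using sublinear_uminus[OF q, of "- a"] a by auto
  ultimately show ?thesis by simp
qed

text \<open>
  A minimal sublinear functional is odd, and an odd sublinear functional is linear. Minimising below
  a functional \<open>p'\<close> that is dominated by \<open>f\<close> on \<open>U\<close> gives a linear functional that agrees with \<open>f\<close> on
  \<open>U\<close>, because one linear functional cannot lie strictly below another. Linearity is over the reals.
\<close>

lemma hahn_banach_sublinear:
  assumes p: "sublinear_on s V p"
    and U: "subspace U" "U \<subseteq> V"
    and f: "\<And>x y. x \<in> U \<Longrightarrow> y \<in> U \<Longrightarrow> f (x + y) = f x + f y"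
      "\<And>t x. x \<in> U \<Longrightarrow> f (s (of_real t) x) = t * f x"
      "\<And>x. x \<in> U \<Longrightarrow> f x \<le> p x"
  shows "\<exists>g. (\<forall>x\<in>V. \<forall>y\<in>V. g (x + y) = g x + g y) \<and>
    (\<forall>t. \<forall>x\<in>V. g (s (of_real t) x) = t * g x) \<and> (\<forall>x\<in>V. g x \<le> p x) \<and> (\<forall>x\<in>U. g x = f x)"
proof -
  have fneg: "f (- x) = - f x" if "x \<in> U" for x
    using f(2)[OF that, of "-1"] by simp
  have "\<exists>p'. sublinear_on s V p' \<and> (\<forall>x\<in>V. p' x \<le> p x) \<and> (\<forall>k\<in>U. p' k \<le> f k)"
  proof (rule sublinear_below_cone[OF p])
    show "- p (- k) \<le> f k" if "k \<in> U" for k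
      using f(3)[of "- k"] that fneg U(1) by (auto simp: subspace_neg)
    show "f 0 = 0" using f(2)[of 0 0] U by (simp add: subspace_0)
  qed (use U f in \<open>auto simp: subspace_0 subspace_add subspace_scale\<close>)
  then obtain p' where p': "sublinear_on s V p'" "\<forall>x\<in>V. p' x \<le> p x" "\<forall>k\<in>U. p' k \<le> f k"
    by blast
  from exists_minimal_sublinear[OF p'(1)] obtain q where
    q: "sublinear_on s V q" "\<forall>x\<in>V. q x \<le> p' x"
    and min: "\<And>r. sublinear_on s V r \<Longrightarrow> \<forall>x\<in>V. r x \<le> q x \<Longrightarrow> \<forall>x\<in>V. r x = q x"
    by blast
  have odd: "q (- x) = - q x" if "x \<in> V" for x
    using minimal_sublinear_odd[OF q(1) min that] by blast
  have qadd: "q (x + y) \<le> q x + q y" if "x \<in> V" "y \<in> V" for x y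
    using q(1) that by (auto simp: sublinear_on_def)
  have qscale: "q (s (of_real t) x) = t * q x" if "x \<in> V" "t \<ge> 0" for x t
    using q(1) that by (auto simp: sublinear_on_def)
  have "q (x + y) = q x + q y" if "x \<in> V" "y \<in> V" for x y
  proof (rule antisym)
    have "q (- x + - y) \<le> q (- x) + q (- y)" using that by (intro qadd) auto
    moreover have "q (- x + - y) = - q (x + y)"
      using odd[of "x + y"] that by (simp add: add_V)
    ultimately show "q x + q y \<le> q (x + y)" using odd that by simp
  qed (rule qadd[OF that])
  moreover have "q (s (of_real t) x) = t * q x" if "x \<in> V" for t x
  proof (cases "t \<ge> 0")
    case False
    then have "q (s (of_real (- t)) x) = - t * q x" using that by (intro qscale) auto
    moreover have "q (s (of_real (- t)) x) = - q (s (of_real t) x)"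
      using odd[of "s (of_real t) x"] that by (simp add: scale_V)
    ultimately show ?thesis by simp
  qed (use that qscale in auto)
  moreover have "q x \<le> p x" if "x \<in> V" for x
    using q(2) p'(2) that by (meson order_trans)
  moreover have "q x = f x" if "x \<in> U" for x
  proof (rule antisym)
    show "q x \<le> f x" using q(2) p'(3) that U(2) by (meson order_trans subsetD)
    have "- x \<in> U" using that U(1) by (simp add: subspace_neg)
    then have "q (- x) \<le> f (- x)" using q(2) p'(3) U(2) by (meson order_trans subsetD)
    then show "f x \<le> q x" using odd[of x] fneg[OF that] that U(2) by auto
  qed
  ultimately show ?thesis by (intro exI[of _ q]) auto
qed

end

text \<open>
  A real part \<open>\<rho>\<close> for the scalar field that treats both fields at once: \<open>j\<close> is the imaginary unit in
  the complex case and \<open>0\<close> in the real case. The formula \<open>z = \<rho> z - j * \<rho> (j * z)\<close> recovers a scalar,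
  and with it a linear functional, from its real part.
\<close>

lemma scalar_reconstruction:
  "\<exists>(\<rho> :: 'k::real_or_complex_field \<Rightarrow> real) j.
    (\<forall>z w. \<rho> (z + w) = \<rho> z + \<rho> w) \<and> (\<forall>a z. \<rho> (of_real a * z) = a * \<rho> z) \<and>
    (\<forall>z. \<bar>\<rho> z\<bar> \<le> norm z) \<and> (\<forall>a b. \<rho> (of_real a - j * of_real b) = a) \<and>
    (\<forall>z. z = of_real (\<rho> z) - j * of_real (\<rho> (j * z))) \<and>
    (\<forall>z. \<exists>a b. z = of_real a + j * of_real b) \<and> (j = 0 \<or> j * j = - 1)"
proof (cases "\<forall>z::'k. \<exists>a. z = a *\<^sub>R 1")
  case True
  then obtain \<rho> :: "'k \<Rightarrow> real" where \<rho>: "\<And>z. z = of_real (\<rho> z)"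
    unfolding of_real_def by metis
  have inv: "\<rho> (of_real a) = a" for a
    using \<rho>[of "of_real a"] by (metis of_real_eq_iff)
  have "\<rho> (z + w) = \<rho> z + \<rho> w" for z w
    by (metis \<rho> inv of_real_add)
  moreover have "\<rho> (of_real a * z) = a * \<rho> z" for a z
    by (metis \<rho> inv of_real_mult)
  moreover have "\<bar>\<rho> z\<bar> \<le> norm z" for z
    by (metis \<rho> norm_of_real order_refl)
  moreover have "\<exists>a b. z = of_real a + 0 * of_real b" for z :: 'k
    using \<rho>[of z] by auto
  ultimately show ?thesis
    using \<rho> inv by (intro exI[of _ \<rho>] exI[of _ 0]) auto
next
  case False
  then obtain j :: 'k where j: "j * j = - 1" and ex: "\<And>z. \<exists>a b. z = a *\<^sub>R 1 + b *\<^sub>R j"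
    and nrm: "\<And>a b. norm (a *\<^sub>R 1 + b *\<^sub>R j) = sqrt (a\<^sup>2 + b\<^sup>2)"
    using real_or_complex by blast
  from ex obtain \<rho> \<mu> :: "'k \<Rightarrow> real" where ri: "\<And>z. z = of_real (\<rho> z) + j * of_real (\<mu> z)"
    unfolding of_real_def by (metis mult_scaleR_right mult.right_neutral)
  have nrm': "norm (of_real a + j * of_real b) = sqrt (a\<^sup>2 + b\<^sup>2)" for a b
    using nrm[of a b] by (simp add: of_real_def)
  have uniq: "a = c \<and> b = d" if "of_real a + j * of_real b = of_real c + j * of_real d" for a b c d :: real
  proof -
    have "of_real (a - c) + j * of_real (b - d) = (0::'k)"
      using that by (simp add: algebra_simps)
    then have "sqrt ((a - c)\<^sup>2 + (b - d)\<^sup>2) = 0"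
      using nrm'[of "a - c" "b - d"] by simp
    then show ?thesis by (simp add: sum_power2_eq_zero_iff)
  qed
  have \<rho>I: "\<rho> z = a" if "z = of_real a + j * of_real b" for z a b
    using uniq that ri[of z] by metis
  have "\<rho> (z + w) = \<rho> z + \<rho> w" for z w
    by (rule \<rho>I[of _ _ "\<mu> z + \<mu> w"], subst ri[of z], subst ri[of w]) (simp add: algebra_simps)
  moreover have "\<rho> (of_real a * z) = a * \<rho> z" for a z
    by (rule \<rho>I[of _ _ "a * \<mu> z"], subst ri[of z]) (simp add: algebra_simps)
  moreover have "\<bar>\<rho> z\<bar> \<le> norm z" for z
  proof -
    have "norm z = sqrt ((\<rho> z)\<^sup>2 + (\<mu> z)\<^sup>2)" using nrm' ri by metis
    then show ?thesis by (simp add: real_le_rsqrt)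
  qed
  moreover have "\<rho> (of_real a - j * of_real b) = a" for a b
    by (rule \<rho>I[of _ _ "- b"]) simp
  moreover have "z = of_real (\<rho> z) - j * of_real (\<rho> (j * z))" for z
  proof -
    have "j * z = of_real (- \<mu> z) + j * of_real (\<rho> z)"
      by (subst ri[of z]) (simp add: algebra_simps j flip: mult.assoc)
    then have "\<rho> (j * z) = - \<mu> z" by (rule \<rho>I)
    then show ?thesis by (subst ri[of z]) simp
  qed
  ultimately show ?thesis
    using ri j by (intro exI[of _ \<rho>] exI[of _ j]) blast
qed

lemma exists_unimodular:
  obtains c :: "'k::real_or_complex_field" where "norm c = 1" "c * z = of_real (norm z)"
proof (cases "z = 0")
  case False
  then show ?thesis
    by (intro that[of "of_real (norm z) / z"]) (auto simp: norm_divide)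
qed (use that[of 1] in auto)

context carrier_space
begin

text \<open>
  The real part of \<open>f\<close> extends to a real-linear \<open>u\<close> below \<open>p\<close>, and \<open>x \<mapsto> u x - j * u (j x)\<close> is the
  scalar-linear functional with real part \<open>u\<close>. Its bound follows from that of \<open>u\<close> after rotating \<open>x\<close>
  by a unimodular scalar that makes the value real.
\<close>

lemma hahn_banach_seminorm:
  assumes p: "\<And>x y. x \<in> V \<Longrightarrow> y \<in> V \<Longrightarrow> p (x + y) \<le> p x + p y"
      "\<And>c x. x \<in> V \<Longrightarrow> p (s c x) = norm c * p x"
    and U: "subspace U" "U \<subseteq> V"
    and f: "\<And>x y. x \<in> U \<Longrightarrow> y \<in> U \<Longrightarrow> f (x + y) = f x + f y"
      "\<And>c x. x \<in> U \<Longrightarrow> f (s c x) = c * f x"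
      "\<And>x. x \<in> U \<Longrightarrow> norm (f x) \<le> p x"
  obtains g where "\<And>x y. x \<in> V \<Longrightarrow> y \<in> V \<Longrightarrow> g (x + y) = g x + g y"
      "\<And>c x. x \<in> V \<Longrightarrow> g (s c x) = c * g x"
      "\<And>x. x \<in> V \<Longrightarrow> norm (g x) \<le> p x"
      "\<And>x. x \<in> U \<Longrightarrow> g x = f x"
proof -
  obtain \<rho> :: "'k \<Rightarrow> real" and j where
    \<rho>: "\<And>z w. \<rho> (z + w) = \<rho> z + \<rho> w" "\<And>a z. \<rho> (of_real a * z) = a * \<rho> z" "\<And>z. \<bar>\<rho> z\<bar> \<le> norm z"
      "\<And>a b. \<rho> (of_real a - j * of_real b) = a"
    and rec: "\<And>z. z = of_real (\<rho> z) - j * of_real (\<rho> (j * z))"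
    and split: "\<And>z. \<exists>a b. z = of_real a + j * of_real b" and j: "j = 0 \<or> j * j = - 1"
    using scalar_reconstruction[where 'k='k] by blast
  have "sublinear_on s V p"
    using p by (auto simp: sublinear_on_def)
  moreover have "\<rho> (f x) \<le> p x" if "x \<in> U" for x
    using \<rho>(3)[of "f x"] f(3)[OF that] by linarith
  ultimately have "\<exists>u. (\<forall>x\<in>V. \<forall>y\<in>V. u (x + y) = u x + u y) \<and>
      (\<forall>t. \<forall>x\<in>V. u (s (of_real t) x) = t * u x) \<and> (\<forall>x\<in>V. u x \<le> p x) \<and> (\<forall>x\<in>U. u x = \<rho> (f x))"
    using U f \<rho> by (intro hahn_banach_sublinear) auto
  then obtain u where u: "\<And>x y. x \<in> V \<Longrightarrow> y \<in> V \<Longrightarrow> u (x + y) = u x + u y"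
      "\<And>t x. x \<in> V \<Longrightarrow> u (s (of_real t) x) = t * u x"
      "\<And>x. x \<in> V \<Longrightarrow> u x \<le> p x" "\<And>x. x \<in> U \<Longrightarrow> u x = \<rho> (f x)"
    by blast
  define g where "g x = of_real (u x) - j * of_real (u (s j x))" for x
  have gadd: "g (x + y) = g x + g y" if "x \<in> V" "y \<in> V" for x y
    using that u(1)[of "s j x" "s j y"] u(1)[of x y]
    by (simp add: g_def scale_right_distrib scale_V algebra_simps)
  have greal: "g (s (of_real a) x) = of_real a * g x" if "x \<in> V" for a x
  proof -
    have "s j (s (of_real a) x) = s (of_real a) (s j x)" by (simp add: mult.commute)
    then show ?thesis
      using that u(2)[of x a] u(2)[of "s j x" a] by (simp add: g_def scale_V algebra_simps)
  qed
  have gj: "g (s j x) = j * g x" if "x \<in> V" for x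
    using j
  proof
    assume "j = 0"
    with u(2)[of 0 0] show ?thesis by (simp add: g_def)
  next
    assume jj: "j * j = - 1"
    have "u (- x) = - u x" using u(2)[OF that, of "-1"] by simp
    with jj show ?thesis by (simp add: g_def algebra_simps flip: mult.assoc)
  qed
  have gscale: "g (s c x) = c * g x" if "x \<in> V" for c x
  proof -
    obtain a b where c: "c = of_real a + j * of_real b" using split by blast
    have "s c x = s (of_real a) x + s (of_real b) (s j x)"
      by (simp add: c scale_left_distrib mult.commute)
    then have "g (s c x) = of_real a * g x + of_real b * (j * g x)"
      using that by (simp add: gadd greal gj scale_V del: scale_scale)
    then show ?thesis by (simp add: c algebra_simps)
  qed
  show thesis
  proof (rule that[of g])
    show "norm (g x) \<le> p x" if "x \<in> V" for x
    proof -
      obtain c where c: "norm c = 1" "c * g x = of_real (norm (g x))" by (rule exists_unimodular)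
      have "norm (g x) = \<rho> (c * g x)" using c \<rho>(4)[of "norm (g x)" 0] by simp
      also have "\<dots> = \<rho> (g (s c x))" using gscale that by simp
      also have "\<dots> = u (s c x)" by (simp add: g_def \<rho>(4))
      also have "\<dots> \<le> p (s c x)" using that by (intro u(3)) auto
      also have "\<dots> = p x" using c p(2)[OF that] by simp
      finally show ?thesis .
    qed
    show "g x = f x" if "x \<in> U" for x
    proof -
      have "s j x \<in> U" using that U(1) by (simp add: subspace_scale)
      then show ?thesis using that u(4) f(2) rec[of "f x"] by (simp add: g_def)
    qed
  qed (use gadd gscale in auto)
qed

end

section \<open>Dual norms and Zabreiko's lemma\<close>

locale normed_carrier = carrier_space s V
  for s :: "'k::real_or_complex_field \<Rightarrow> 'v::ab_group_add \<Rightarrow> 'v" and V +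
  fixes N :: "'v \<Rightarrow> real"
  assumes N_triangle: "x \<in> V \<Longrightarrow> y \<in> V \<Longrightarrow> N (x + y) \<le> N x + N y"
    and N_scale: "x \<in> V \<Longrightarrow> N (s c x) = norm c * N x"
begin

lemma N_zero [simp]: "N 0 = 0"
  using N_scale[of 0 0] by simp

lemma N_uminus: "x \<in> V \<Longrightarrow> N (- x) = N x"
  using N_scale[of x "-1"] by simp

lemma N_minus_commute: "x \<in> V \<Longrightarrow> y \<in> V \<Longrightarrow> N (x - y) = N (y - x)"
  using N_uminus[of "x - y"] by (simp add: diff_V)

lemma N_nonneg: "x \<in> V \<Longrightarrow> 0 \<le> N x"
  using N_triangle[of x "- x"] by (simp add: N_uminus uminus_V)

lemma N_triangle_diff: "x \<in> V \<Longrightarrow> y \<in> V \<Longrightarrow> N (x - y) \<le> N x + N y"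
  using N_triangle[of x "- y"] by (simp add: N_uminus uminus_V)

lemma dualI:
  assumes "\<And>x y. x \<in> V \<Longrightarrow> y \<in> V \<Longrightarrow> f (x + y) = f x + f y"
    and "\<And>c x. x \<in> V \<Longrightarrow> f (s c x) = c * f x"
    and "\<And>x. x \<in> V \<Longrightarrow> norm (f x) \<le> C * N x"
    and "\<And>x. x \<notin> V \<Longrightarrow> f x = 0"
  shows "f \<in> dual s V N"
  using assms unfolding dual_def by blast

lemma dual_add: "f \<in> dual s V N \<Longrightarrow> x \<in> V \<Longrightarrow> y \<in> V \<Longrightarrow> f (x + y) = f x + f y"
  and dual_scale: "f \<in> dual s V N \<Longrightarrow> x \<in> V \<Longrightarrow> f (s c x) = c * f x"
  and dual_outside: "f \<in> dual s V N \<Longrightarrow> x \<notin> V \<Longrightarrow> f x = 0"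
  unfolding dual_def by auto

lemma dual_diff:
  assumes "f \<in> dual s V N" "x \<in> V" "y \<in> V"
  shows "f (x - y) = f x - f y"
  using dual_add[OF assms(1), of "x - y" y] assms by (simp add: diff_V)

lemma zero_unit_ball [simp]: "0 \<in> unit_ball V N"
  by (simp add: unit_ball_def)

lemma bdd_above_dual:
  assumes "f \<in> dual s V N"
  shows "bdd_above ((\<lambda>x. norm (f x)) ` unit_ball V N)"
proof -
  from assms obtain C where C: "\<And>x. x \<in> V \<Longrightarrow> norm (f x) \<le> C * N x"
    unfolding dual_def by blast
  have "norm (f x) \<le> \<bar>C\<bar>" if "x \<in> unit_ball V N" for x
  proof -
    have x: "x \<in> V" "0 \<le> N x" "N x \<le> 1" using that N_nonneg by (auto simp: unit_ball_def)
    have "C * N x \<le> \<bar>C\<bar> * 1" using x by (intro mult_mono) auto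
    with C[OF x(1)] show ?thesis by simp
  qed
  then show ?thesis by (rule bdd_aboveI2)
qed

text \<open>
  If \<open>N x = 0\<close> the vector cannot be normalised, but then \<open>f x = 0\<close> by boundedness of \<open>f\<close>.
\<close>

lemma norm_le_dual_norm:
  assumes f: "f \<in> dual s V N" and x: "x \<in> V"
  shows "norm (f x) \<le> dual_norm V N f * N x"
proof (cases "N x = 0")
  case True
  from f obtain C where "norm (f x) \<le> C * N x"
    using x unfolding dual_def by blast
  with True show ?thesis by simp
next
  case False
  then have pos: "N x > 0" using N_nonneg[OF x] by simp
  have "s (of_real (1 / N x)) x \<in> unit_ball V N"
    using pos x by (auto simp: unit_ball_def N_scale norm_divide)
  then have "norm (f (s (of_real (1 / N x)) x)) \<le> dual_norm V N f"
    unfolding dual_norm_def by (intro cSUP_upper bdd_above_dual f)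
  also have "f (s (of_real (1 / N x)) x) = of_real (1 / N x) * f x"
    using f x by (rule dual_scale)
  finally show ?thesis using pos by (simp add: norm_mult norm_divide field_simps)
qed

lemma dual_norm_leI:
  assumes "0 \<le> C" "\<And>x. x \<in> V \<Longrightarrow> norm (f x) \<le> C * N x"
  shows "dual_norm V N f \<le> C"
  unfolding dual_norm_def
proof (rule cSUP_least)
  fix x assume "x \<in> unit_ball V N"
  then have x: "x \<in> V" "N x \<le> 1" by (auto simp: unit_ball_def)
  have "norm (f x) \<le> C * N x" using assms(2) x(1) .
  also have "\<dots> \<le> C * 1" using assms(1) x(2) by (intro mult_left_mono)
  finally show "norm (f x) \<le> C" by simp
qed (use zero_unit_ball in blast)

lemma dual_norm_nonneg: "f \<in> dual s V N \<Longrightarrow> 0 \<le> dual_norm V N f"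
  unfolding dual_norm_def
  by (rule cSUP_upper2[OF bdd_above_dual zero_unit_ball]) auto

lemma dual_norm_approx:
  assumes "f \<in> dual s V N" "e > 0"
  obtains x where "x \<in> unit_ball V N" "dual_norm V N f - e < norm (f x)"
proof -
  have "\<exists>x\<in>unit_ball V N. dual_norm V N f - e < norm (f x)"
    unfolding dual_norm_def using assms(2) less_cSUP_iff[OF _ bdd_above_dual[OF assms(1)]]
    by (metis diff_less empty_iff less_add_same_cancel1 diff_less_eq zero_unit_ball)
  then show thesis using that by blast
qed

text \<open>
  Duals are again spaces of the same kind, so that all facts on dual norms apply to biduals as well.
\<close>

lemma normed_carrier_dual: "normed_carrier fun_scale (dual s V N) (dual_norm V N)"
proof -
  interpret F: vector_space "fun_scale :: 'k \<Rightarrow> ('v \<Rightarrow> 'k) \<Rightarrow> _"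
    by unfold_locales (auto simp: fun_scale_def fun_eq_iff algebra_simps)
  have add: "norm ((f + g) x) \<le> (dual_norm V N f + dual_norm V N g) * N x"
    if "f \<in> dual s V N" "g \<in> dual s V N" "x \<in> V" for f g x
    using norm_triangle_ineq[of "f x" "g x"] norm_le_dual_norm[OF that(1,3)]
      norm_le_dual_norm[OF that(2,3)] by (simp add: algebra_simps)
  have scale: "norm (fun_scale c f x) \<le> (norm c * dual_norm V N f) * N x"
    if "f \<in> dual s V N" "x \<in> V" for c f x
    using norm_le_dual_norm[OF that]
    by (simp add: fun_scale_def norm_mult mult.assoc mult_left_mono)
  have scale_in: "fun_scale c f \<in> dual s V N" if f: "f \<in> dual s V N" for c f
    by (rule dualI[OF _ _ scale])
      (use f in \<open>auto simp: fun_scale_def dual_add dual_scale dual_outside algebra_simps\<close>)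
  show ?thesis
  proof
    show "F.subspace (dual s V N)"
    proof (rule F.subspaceI)
      show "0 \<in> dual s V N" by (rule dualI[where C = 0]) auto
      show "f + g \<in> dual s V N" if f: "f \<in> dual s V N" and g: "g \<in> dual s V N" for f g
        by (rule dualI[OF _ _ add])
          (use f g in \<open>auto simp: dual_add dual_scale dual_outside algebra_simps\<close>)
    qed (rule scale_in)
    show "dual_norm V N (f + g) \<le> dual_norm V N f + dual_norm V N g"
      if "f \<in> dual s V N" "g \<in> dual s V N" for f g
      using that add by (intro dual_norm_leI) (auto simp: dual_norm_nonneg)
    have le: "dual_norm V N (fun_scale c f) \<le> norm c * dual_norm V N f"
      if "f \<in> dual s V N" for c f
      using that scale by (intro dual_norm_leI) (auto simp: dual_norm_nonneg)
    show "dual_norm V N (fun_scale c f) = norm c * dual_norm V N f"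
      if f: "f \<in> dual s V N" for c f
    proof (cases "c = 0")
      case True
      then show ?thesis
        using le[OF f, of c] dual_norm_nonneg[OF scale_in[OF f], of c] by simp
    next
      case False
      have "dual_norm V N f = dual_norm V N (fun_scale (inverse c) (fun_scale c f))"
        using False by (simp add: fun_scale_def flip: mult.assoc)
      also have "\<dots> \<le> norm (inverse c) * dual_norm V N (fun_scale c f)"
        using f by (intro le scale_in)
      finally show ?thesis
        using False le[OF f, of c] by (simp add: norm_divide field_simps)
    qed
  qed
qed

text \<open>
  Zabreiko's lemma: a countably subadditive seminorm on a Banach space is continuous. By Baire's
  theorem the closure of some set \<open>{x. p x \<le> n}\<close> has an interior point, and by symmetry and convexity
  it contains a ball around the origin. As in the open mapping theorem, every \<open>x\<close> of that ball is then
  the sum of a series whose terms have geometrically decreasing \<open>p\<close>, and countable subadditivity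
  bounds \<open>p x\<close>.
\<close>

lemma countably_subadditive_imp_bounded:
  assumes definite: "\<And>x. x \<in> V \<Longrightarrow> N x = 0 \<Longrightarrow> x = 0"
    and complete: "\<And>x. (\<And>n. x n \<in> V) \<Longrightarrow> (\<And>e. e > 0 \<Longrightarrow> \<exists>M. \<forall>m\<ge>M. \<forall>n\<ge>M. N (x m - x n) < e) \<Longrightarrow>
      \<exists>y\<in>V. (\<lambda>n. N (x n - y)) \<longlonglongrightarrow> 0"
    and p_diff: "\<And>x y. x \<in> V \<Longrightarrow> y \<in> V \<Longrightarrow> p (x - y) \<le> p x + p y"
    and p_scale: "\<And>t x. x \<in> V \<Longrightarrow> 0 \<le> t \<Longrightarrow> p (s (of_real t) x) = t * p x"
    and p_nonneg: "\<And>x. x \<in> V \<Longrightarrow> 0 \<le> p x"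
    and p_countable: "\<And>x y. (\<And>k. x k \<in> V) \<Longrightarrow> y \<in> V \<Longrightarrow> (\<lambda>n. N ((\<Sum>k<n. x k) - y)) \<longlonglongrightarrow> 0 \<Longrightarrow>
      summable (\<lambda>k. p (x k)) \<Longrightarrow> p y \<le> (\<Sum>k. p (x k))"
  obtains C where "0 \<le> C" "\<And>x. x \<in> V \<Longrightarrow> p x \<le> C * N x"
proof -
  \<comment> \<open>A metric has to be symmetric and nonnegative on the whole type, whence the default \<open>0\<close>.\<close>
  define d where "d x y = (if x \<in> V \<and> y \<in> V then N (x - y) else 0)" for x y
  interpret M: Metric_space V d
  proof
    show "0 \<le> d x y" for x y by (simp add: d_def N_nonneg diff_V)
    show "d x y = d y x" for x y by (simp add: d_def N_minus_commute)
    show "(d x y = 0) = (x = y)" if "x \<in> V" "y \<in> V" for x y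
      using that definite[of "x - y"] by (auto simp: d_def diff_V)
    show "d x z \<le> d x y + d y z" if "x \<in> V" "y \<in> V" "z \<in> V" for x y z
      using that N_triangle[of "x - y" "y - z"] by (simp add: d_def diff_V)
  qed
  have mcomplete: "M.mcomplete"
    unfolding M.mcomplete_def
  proof (intro allI impI)
    fix x assume "M.MCauchy x"
    then have xV: "\<And>n. x n \<in> V" and "\<And>e. e > 0 \<Longrightarrow> \<exists>M. \<forall>m n. M \<le> m \<longrightarrow> M \<le> n \<longrightarrow> d (x m) (x n) < e"
      by (auto simp: M.MCauchy_def)
    then have "\<exists>y\<in>V. (\<lambda>n. N (x n - y)) \<longlonglongrightarrow> 0"
      by (intro complete) (auto simp: d_def)
    then obtain y where y: "y \<in> V" "(\<lambda>n. N (x n - y)) \<longlonglongrightarrow> 0" by blast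
    have "\<exists>n0. \<forall>n\<ge>n0. x n \<in> V \<and> d (x n) y < e" if "e > 0" for e
    proof -
      obtain n0 where "\<forall>n\<ge>n0. norm (N (x n - y) - 0) < e"
        using LIMSEQ_D[OF y(2) \<open>e > 0\<close>] by blast
      then have "\<forall>n\<ge>n0. N (x n - y) < e" by (simp add: abs_less_iff)
      then show ?thesis using xV y(1) by (auto simp: d_def)
    qed
    then show "\<exists>y. limitin M.mtopology x y sequentially"
      using y(1) by (auto simp: M.limit_metric_sequentially)
  qed
  define A where "A n = {x \<in> V. p x \<le> real n}" for n
  have "\<exists>n. M.mtopology interior_of (M.mtopology closure_of A n) \<noteq> {}"
  proof (rule ccontr)
    assume *: "\<not> ?thesis"
    have "M.mtopology interior_of \<Union>(range (\<lambda>n. M.mtopology closure_of A n)) = {}"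
      using * by (intro M.metric_Baire_category_alt mcomplete) auto
    moreover have "\<Union>(range (\<lambda>n. M.mtopology closure_of A n)) = topspace M.mtopology"
    proof (intro equalityI subsetI)
      fix x assume "x \<in> topspace M.mtopology"
      then have x: "x \<in> V" by simp
      obtain n where "p x \<le> real n" using real_arch_simple by blast
      then have "x \<in> A n" using x by (simp add: A_def)
      then have "x \<in> M.mtopology closure_of A n"
        using closure_of_subset[of "A n" M.mtopology] by (auto simp: A_def)
      then show "x \<in> \<Union>(range (\<lambda>n. M.mtopology closure_of A n))" by blast
    qed (use closure_of_subset_topspace in fastforce)
    ultimately show False
      by (metis empty_iff interior_of_topspace M.topspace_mtopology zero_V)
  qed
  then obtain n a r where r: "r > 0" and a: "a \<in> V" and ball: "M.mball a r \<subseteq> M.mtopology closure_of A n"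
    by (auto simp: M.metric_interior_of)
  \<comment> \<open>Half the difference of approximants of \<open>a + x\<close> and \<open>a - x\<close> approximates \<open>x\<close>.\<close>
  have approx: "\<exists>u\<in>V. p u \<le> real n \<and> N (x - u) < e" if x: "x \<in> V" "N x < r" and e: "e > 0" for x e
  proof -
    have "a + x \<in> M.mball a r" "a - x \<in> M.mball a r"
      using x a by (auto simp: M.in_mball d_def N_uminus add_V diff_V)
    with ball have "a + x \<in> M.mtopology closure_of A n" "a - x \<in> M.mtopology closure_of A n" by auto
    then obtain u v where u: "u \<in> A n" "u \<in> M.mball (a + x) e" and v: "v \<in> A n" "v \<in> M.mball (a - x) e"
      using e unfolding M.metric_closure_of by blast
    then have uv: "u \<in> V" "v \<in> V" "p u \<le> real n" "p v \<le> real n" "N (a + x - u) < e" "N (a - x - v) < e"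
      using x a by (auto simp: A_def M.in_mball d_def add_V diff_V split: if_splits)
    define w where "w = s (of_real (1/2)) (u - v)"
    have "p w = 1/2 * p (u - v)" unfolding w_def using uv by (intro p_scale) auto
    also have "\<dots> \<le> real n" using p_diff[of u v] uv by simp
    finally have pw: "p w \<le> real n" .
    have "x = s (of_real (1/2)) (x + x)"
      using scale_left_distrib[of "of_real (1/2)" "of_real (1/2)" x]
      by (simp add: scale_right_distrib flip: of_real_add)
    then have "x - w = s (of_real (1/2)) (x + x) - s (of_real (1/2)) (u - v)"
      unfolding w_def by argo
    also have "\<dots> = s (of_real (1/2)) ((a + x - u) - (a - x - v))"
      by (simp only: scale_right_diff_distrib[symmetric]) (simp add: algebra_simps)
    also have "N \<dots> = 1/2 * N ((a + x - u) - (a - x - v))"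
      using uv x a by (subst N_scale) (auto intro!: diff_V add_V)
    also have "\<dots> \<le> 1/2 * (N (a + x - u) + N (a - x - v))"
      using uv x a by (intro mult_left_mono N_triangle_diff) (auto intro!: diff_V add_V)
    also have "\<dots> < e" using uv by simp
    finally show ?thesis using pw uv by (intro bexI[of _ w]) (auto simp: w_def)
  qed
  have step: "\<exists>u\<in>V. p u \<le> real n * t \<and> N (x - u) < r * t / 2"
    if x: "x \<in> V" "N x < r * t" and t: "t > 0" for x t
  proof -
    have "N (s (of_real (1/t)) x) < r"
      using x t by (simp add: N_scale norm_divide field_simps)
    then obtain u where u: "u \<in> V" "p u \<le> real n" "N (s (of_real (1/t)) x - u) < r / 2"
      using approx[of "s (of_real (1/t)) x" "r/2"] x r by auto
    have "x - s (of_real t) u = s (of_real t) (s (of_real (1/t)) x - u)"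
      using t by (simp add: scale_right_diff_distrib flip: of_real_mult)
    then have "N (x - s (of_real t) u) = t * N (s (of_real (1/t)) x - u)"
      using u x t by (simp add: N_scale diff_V scale_V)
    also have "\<dots> < t * (r / 2)" using u t by (intro mult_strict_left_mono)
    finally have "N (x - s (of_real t) u) < r * t / 2" by (simp add: mult.commute)
    moreover have "p (s (of_real t) u) \<le> real n * t"
      using u t p_scale[of u t] by (simp add: mult.commute mult_right_mono)
    ultimately show ?thesis using u by (intro bexI[of _ "s (of_real t) u"]) auto
  qed
  have small: "p x \<le> 2 * real n" if x: "x \<in> V" "N x < r" for x
  proof -
    \<comment> \<open>\<open>y k\<close> is the remainder of \<open>x\<close> after \<open>k\<close> approximations; the terms of the series are \<open>y k - y (Suc k)\<close>.\<close>
    have "\<exists>y. \<forall>k. (y k \<in> V \<and> N (y k) < r * (1/2)^k \<and> (k = 0 \<longrightarrow> y k = x)) \<and>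
        p (y k - y (Suc k)) \<le> real n * (1/2)^k"
    proof (rule dependent_nat_choice)
      show "\<exists>y. y \<in> V \<and> N y < r * (1/2)^0 \<and> (0 = (0::nat) \<longrightarrow> y = x)" using x by auto
      show "\<exists>z. (z \<in> V \<and> N z < r * (1/2)^Suc k \<and> (Suc k = 0 \<longrightarrow> z = x)) \<and>
          p (y - z) \<le> real n * (1/2)^k"
        if y: "y \<in> V \<and> N y < r * (1/2)^k \<and> (k = 0 \<longrightarrow> y = x)" for y k
      proof -
        obtain u where "u \<in> V" "p u \<le> real n * (1/2)^k" "N (y - u) < r * (1/2)^k / 2"
          using step[of y "(1/2)^k"] y by auto
        then show ?thesis using y by (intro exI[of _ "y - u"]) (auto simp: diff_V)
      qed
    qed
    then obtain y where y: "\<And>k. y k \<in> V" "\<And>k. N (y k) < r * (1/2)^k" "y 0 = x"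
      "\<And>k. p (y k - y (Suc k)) \<le> real n * (1/2)^k"
      by metis
    have geo: "summable (\<lambda>k. real n * (1/2)^k)" "(\<Sum>k. real n * (1/2)^k) = 2 * real n"
      using summable_geometric[of "1/2::real"] suminf_geometric[of "1/2::real"]
      by (auto simp: summable_mult suminf_mult)
    have summ: "summable (\<lambda>k. p (y k - y (Suc k)))"
    proof (rule summable_comparison_test'[OF geo(1)])
      show "norm (p (y k - y (Suc k))) \<le> real n * (1/2)^k" for k
        using y(1,4) p_nonneg[of "y k - y (Suc k)"] by (simp add: diff_V)
    qed
    have "p x \<le> (\<Sum>k. p (y k - y (Suc k)))"
    proof (rule p_countable[OF _ x(1) _ summ])
      have "N ((\<Sum>k<m. y k - y (Suc k)) - x) = N (y m)" for m
        using y(1,3) by (simp add: sum_lessThan_telescope' N_uminus)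
      moreover have "(\<lambda>m. N (y m)) \<longlonglongrightarrow> 0"
      proof (rule tendsto_sandwich[of "\<lambda>_. 0" _ _ "\<lambda>m. r * (1/2)^m"])
        show "(\<lambda>m. r * (1/2)^m) \<longlonglongrightarrow> 0"
          using tendsto_mult_right_zero[OF LIMSEQ_power_zero[of "1/2::real"]] by simp
      qed (use y N_nonneg in \<open>auto intro!: always_eventually less_imp_le\<close>)
      ultimately show "(\<lambda>m. N ((\<Sum>k<m. y k - y (Suc k)) - x)) \<longlonglongrightarrow> 0" by simp
    qed (use y in auto)
    also have "\<dots> \<le> (\<Sum>k. real n * (1/2)^k)"
      using y(4) summ geo(1) by (rule suminf_le)
    finally show ?thesis using geo(2) by simp
  qed
  show thesis
  proof (rule that[of "4 * real n / r"])
    show "p x \<le> 4 * real n / r * N x" if x: "x \<in> V" for x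
    proof (cases "N x = 0")
      case True
      then have "x = 0" using definite x by blast
      then show ?thesis using p_scale[of 0 0] by simp
    next
      case False
      then have pos: "N x > 0" using N_nonneg[OF x] by simp
      define t where "t = r / (2 * N x)"
      have t: "t > 0" using r pos by (simp add: t_def)
      have "t * p x = p (s (of_real t) x)" using x t by (simp add: p_scale)
      also have "\<dots> \<le> 2 * real n"
        using x t pos r by (intro small) (auto simp: N_scale t_def norm_divide norm_mult field_simps)
      finally show ?thesis using r pos by (simp add: t_def field_simps)
    qed
  qed (use r in auto)
qed

end

section \<open>Functions vanishing at infinity\<close>

definition pointwise_scale :: "('k \<Rightarrow> 'y \<Rightarrow> 'y) \<Rightarrow> 'k \<Rightarrow> ('a \<Rightarrow> 'y) \<Rightarrow> 'a \<Rightarrow> 'y"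
  where "pointwise_scale sY c f = (\<lambda>t. sY c (f t))"

text \<open>
  The space \<open>C\<^sub>0\<close>, with functions extended by \<open>0\<close> outside the space, in contrast to the extensional
  functions of \<open>C0\<close>. With this convention it is a vector space under the pointwise operations.
\<close>

definition vanishing :: "'a topology \<Rightarrow> ('a \<Rightarrow> 'y::real_normed_vector) set"
  where "vanishing \<tau> = {f. continuous_map \<tau> euclidean f \<and> (\<forall>t. t \<notin> topspace \<tau> \<longrightarrow> f t = 0) \<and>
    (\<forall>e>0. compactin \<tau> {t \<in> topspace \<tau>. e \<le> norm (f t)})}"

text \<open>
  The supremum ranges over the whole type, which is never empty; the points outside the topological
  space contribute \<open>0\<close>.
\<close>

definition sup_norm :: "('a \<Rightarrow> 'y::real_normed_vector) \<Rightarrow> real"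
  where "sup_norm f = (SUP t. norm (f t))"

text \<open>
  It suffices to enclose the sets \<open>{t. e \<le> norm (f t)}\<close> in compact sets, because they are closed.
\<close>

lemma vanishingI:
  assumes f: "continuous_map \<tau> euclidean f" "\<And>t. t \<notin> topspace \<tau> \<Longrightarrow> f t = 0"
    and K: "\<And>e. e > 0 \<Longrightarrow> \<exists>K. compactin \<tau> K \<and> {t \<in> topspace \<tau>. e \<le> norm (f t)} \<subseteq> K"
  shows "f \<in> vanishing \<tau>"
proof -
  have "compactin \<tau> {t \<in> topspace \<tau>. e \<le> norm (f t)}" if "e > 0" for e
  proof -
    from K[OF that] obtain K where "compactin \<tau> K" "{t \<in> topspace \<tau>. e \<le> norm (f t)} \<subseteq> K" by blast
    moreover have "closedin \<tau> {t \<in> topspace \<tau>. norm (f t) \<in> {e..}}"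
      by (rule closedin_continuous_map_preimage[OF continuous_map_norm[OF f(1)]]) simp
    ultimately show ?thesis by (auto intro: closed_compactin)
  qed
  with f show ?thesis by (auto simp: vanishing_def)
qed

lemma bounded_on_compactin:
  fixes f :: "'a \<Rightarrow> 'y::real_normed_vector"
  assumes "continuous_map \<tau> euclidean f" "compactin \<tau> K"
  obtains B where "0 \<le> B" "\<And>t. t \<in> K \<Longrightarrow> norm (f t) \<le> B"
proof -
  have "compact (f ` K)"
    using image_compactin[OF assms(2,1)] by simp
  then have "bounded (f ` K)" by (rule compact_imp_bounded)
  then obtain B where B: "\<And>y. y \<in> f ` K \<Longrightarrow> norm y \<le> B"
    unfolding bounded_iff by blast
  show thesis by (rule that[of "max B 0"]) (use B in \<open>auto simp: le_max_iff_disj\<close>)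
qed

lemma bdd_above_vanishing:
  assumes "f \<in> vanishing \<tau>"
  shows "bdd_above (range (\<lambda>t. norm (f t)))"
proof -
  have "continuous_map \<tau> euclidean f" "compactin \<tau> {t \<in> topspace \<tau>. 1 \<le> norm (f t)}"
    using assms by (auto simp: vanishing_def)
  then obtain B where B: "0 \<le> B" "\<And>t. t \<in> {t \<in> topspace \<tau>. 1 \<le> norm (f t)} \<Longrightarrow> norm (f t) \<le> B"
    by (rule bounded_on_compactin) blast
  have "norm (f t) \<le> max B 1" for t
  proof (cases "t \<in> topspace \<tau> \<and> 1 \<le> norm (f t)")
    case False
    then have "norm (f t) \<le> 1" using assms by (auto simp: vanishing_def)
    then show ?thesis by simp
  qed (use B in fastforce)
  then show ?thesis by (rule bdd_aboveI2)
qed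

lemma norm_le_sup_norm: "f \<in> vanishing \<tau> \<Longrightarrow> norm (f t) \<le> sup_norm f"
  unfolding sup_norm_def by (rule cSUP_upper) (auto intro: bdd_above_vanishing)

lemma sup_norm_leI: "(\<And>t. norm (f t) \<le> c) \<Longrightarrow> sup_norm f \<le> c"
  unfolding sup_norm_def by (rule cSUP_least) auto

lemma continuous_map_scaleR:
  fixes f :: "'a \<Rightarrow> 'y::real_normed_vector"
  assumes "continuous_map \<tau> euclideanreal \<eta>" "continuous_map \<tau> euclidean f"
  shows "continuous_map \<tau> euclidean (\<lambda>t. \<eta> t *\<^sub>R f t)"
  using assms by (auto simp: continuous_map_atin limitin_canonical_iff intro: tendsto_scaleR)

lemma vanishing_mult:
  assumes \<eta>: "continuous_map \<tau> euclideanreal \<eta>" "\<And>t. \<bar>\<eta> t\<bar> \<le> 1"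
    and f: "f \<in> vanishing \<tau>"
  shows "(\<lambda>t. \<eta> t *\<^sub>R f t) \<in> vanishing \<tau>"
proof (rule vanishingI)
  show "continuous_map \<tau> euclidean (\<lambda>t. \<eta> t *\<^sub>R f t)"
    using \<eta>(1) f by (intro continuous_map_scaleR) (auto simp: vanishing_def)
  show "\<exists>K. compactin \<tau> K \<and> {t \<in> topspace \<tau>. e \<le> norm (\<eta> t *\<^sub>R f t)} \<subseteq> K" if "e > 0" for e
  proof (intro exI conjI)
    show "compactin \<tau> {t \<in> topspace \<tau>. e \<le> norm (f t)}"
      using f that by (simp add: vanishing_def)
    have "norm (\<eta> t *\<^sub>R f t) \<le> norm (f t)" for t
      using mult_right_mono[OF \<eta>(2)[of t], of "norm (f t)"] by simp
    then show "{t \<in> topspace \<tau>. e \<le> norm (\<eta> t *\<^sub>R f t)} \<subseteq> {t \<in> topspace \<tau>. e \<le> norm (f t)}"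
      using order_trans by blast
  qed
qed (use f in \<open>auto simp: vanishing_def\<close>)

lemma vanishing_cutoff:
  assumes \<eta>: "continuous_map \<tau> euclideanreal \<eta>" "compactin \<tau> K" "\<And>t. t \<in> topspace \<tau> \<Longrightarrow> t \<notin> K \<Longrightarrow> \<eta> t = 0"
    and f: "continuous_map \<tau> euclidean f" "\<And>t. t \<notin> topspace \<tau> \<Longrightarrow> f t = 0"
  shows "(\<lambda>t. \<eta> t *\<^sub>R f t) \<in> vanishing \<tau>"
proof (rule vanishingI)
  show "continuous_map \<tau> euclidean (\<lambda>t. \<eta> t *\<^sub>R f t)"
    using \<eta>(1) f by (intro continuous_map_scaleR)
  show "\<exists>K. compactin \<tau> K \<and> {t \<in> topspace \<tau>. e \<le> norm (\<eta> t *\<^sub>R f t)} \<subseteq> K" if "e > 0" for e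
    using \<eta>(2,3) that by (intro exI[of _ K]) force
qed (use f in auto)

lemma normed_carrier_UNIV:
  assumes "normed_scaling s"
  shows "normed_carrier s UNIV norm"
proof -
  interpret normed_scaling s by fact
  show ?thesis by unfold_locales (auto simp: norm_triangle_ineq norm_scale)
qed

lemma (in normed_scaling) bounded_linear_scale: "bounded_linear (scale c)"
proof
  show "scale c (r *\<^sub>R x) = r *\<^sub>R scale c x" for r x
    by (simp add: mult.commute flip: scale_of_real)
  show "\<exists>K. \<forall>x. norm (scale c x) \<le> norm x * K"
    by (intro exI[of _ "norm c"]) (simp add: norm_scale mult.commute)
qed (rule scale_right_distrib)

lemma normed_carrier_vanishing:
  fixes sY :: "'k::real_or_complex_field \<Rightarrow> 'y::real_normed_vector \<Rightarrow> 'y" and \<tau> :: "'a topology"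
  assumes "normed_scaling sY"
  shows "normed_carrier (pointwise_scale sY) (vanishing \<tau>) sup_norm"
proof -
  interpret Y: normed_scaling sY by fact
  interpret F: vector_space "pointwise_scale sY :: 'k \<Rightarrow> ('a \<Rightarrow> 'y) \<Rightarrow> _"
    by unfold_locales (auto simp: pointwise_scale_def fun_eq_iff Y.scale_left_distrib Y.scale_right_distrib)
  have zero: "0 \<in> vanishing \<tau>"
    by (rule vanishingI) (auto simp: zero_fun_def intro: exI[of _ "{}"])
  have add: "f + g \<in> vanishing \<tau>" if f: "f \<in> vanishing \<tau>" and g: "g \<in> vanishing \<tau>" for f g :: "'a \<Rightarrow> 'y"
  proof (rule vanishingI)
    show "continuous_map \<tau> euclidean (f + g)"
      unfolding plus_fun_def using f g by (intro continuous_map_add) (auto simp: vanishing_def)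
    show "\<exists>K. compactin \<tau> K \<and> {t \<in> topspace \<tau>. e \<le> norm ((f + g) t)} \<subseteq> K" if "e > 0" for e
    proof (intro exI conjI)
      show "compactin \<tau> ({t \<in> topspace \<tau>. e / 2 \<le> norm (f t)} \<union> {t \<in> topspace \<tau>. e / 2 \<le> norm (g t)})"
        using f g half_gt_zero[OF that] unfolding vanishing_def by (blast intro: compactin_Un)
      have "e / 2 \<le> norm (f t) \<or> e / 2 \<le> norm (g t)" if "e \<le> norm (f t + g t)" for t
        using norm_triangle_ineq[of "f t" "g t"] that by linarith
      then show "{t \<in> topspace \<tau>. e \<le> norm ((f + g) t)} \<subseteq>
          {t \<in> topspace \<tau>. e / 2 \<le> norm (f t)} \<union> {t \<in> topspace \<tau>. e / 2 \<le> norm (g t)}"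
        by auto
    qed
  qed (use f g in \<open>auto simp: vanishing_def\<close>)
  have scale: "pointwise_scale sY c f \<in> vanishing \<tau>" if f: "f \<in> vanishing \<tau>" for c and f :: "'a \<Rightarrow> 'y"
  proof (cases "c = 0")
    case True
    then have "pointwise_scale sY c f = 0" by (simp add: pointwise_scale_def fun_eq_iff)
    show ?thesis unfolding \<open>pointwise_scale sY c f = 0\<close> by (rule zero)
  next
    case False
    show ?thesis
    proof (rule vanishingI)
      have "continuous_map euclidean euclidean (sY c)"
        using linear_continuous_on[OF Y.bounded_linear_scale] by simp
      moreover have "continuous_map \<tau> euclidean f" using f by (simp add: vanishing_def)
      ultimately show "continuous_map \<tau> euclidean (pointwise_scale sY c f)"
        unfolding pointwise_scale_def
        using continuous_map_compose[of \<tau> euclidean f euclidean "sY c"] by (simp add: o_def)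
      show "\<exists>K. compactin \<tau> K \<and> {t \<in> topspace \<tau>. e \<le> norm (pointwise_scale sY c f t)} \<subseteq> K"
        if "e > 0" for e
      proof (intro exI conjI)
        show "compactin \<tau> {t \<in> topspace \<tau>. e / norm c \<le> norm (f t)}"
          using f that False by (simp add: vanishing_def)
        show "{t \<in> topspace \<tau>. e \<le> norm (pointwise_scale sY c f t)} \<subseteq>
            {t \<in> topspace \<tau>. e / norm c \<le> norm (f t)}"
          using False by (auto simp: pointwise_scale_def Y.norm_scale field_simps)
      qed
    qed (use f in \<open>auto simp: vanishing_def pointwise_scale_def\<close>)
  qed
  show ?thesis
  proof
    show "F.subspace (vanishing \<tau>)" by (rule F.subspaceI) (use zero add scale in auto)
    show "sup_norm (f + g) \<le> sup_norm f + sup_norm g" if "f \<in> vanishing \<tau>" "g \<in> vanishing \<tau>" for f g :: "'a \<Rightarrow> 'y"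
    proof (rule sup_norm_leI)
      show "norm ((f + g) t) \<le> sup_norm f + sup_norm g" for t
        using norm_triangle_ineq[of "f t" "g t"] norm_le_sup_norm[OF that(1), of t]
          norm_le_sup_norm[OF that(2), of t] by simp
    qed
    have le: "sup_norm (pointwise_scale sY c f) \<le> norm c * sup_norm f" if "f \<in> vanishing \<tau>"
      for c and f :: "'a \<Rightarrow> 'y"
      using norm_le_sup_norm[OF that]
      by (intro sup_norm_leI) (simp add: pointwise_scale_def Y.norm_scale mult_left_mono)
    show "sup_norm (pointwise_scale sY c f) = norm c * sup_norm f" if f: "f \<in> vanishing \<tau>"
      for c and f :: "'a \<Rightarrow> 'y"
    proof (cases "c = 0")
      case True
      then show ?thesis by (simp add: pointwise_scale_def sup_norm_def)
    next
      case False
      have "sup_norm f = sup_norm (pointwise_scale sY (inverse c) (pointwise_scale sY c f))"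
        using False by (simp add: pointwise_scale_def)
      also have "\<dots> \<le> norm (inverse c) * sup_norm (pointwise_scale sY c f)"
        using f by (intro le scale)
      finally show ?thesis
        using False le[OF f, of c] by (simp add: norm_divide field_simps)
    qed
  qed
qed

text \<open>
  This replaces the inner regularity of a representing measure. Let \<open>f\<close> in the unit ball almost attain
  the norm \<open>M\<close> of \<open>\<psi>\<close>. The cutoff \<open>\<eta>\<close> is built from \<open>norm (f t)\<close> itself: it vanishes where
  \<open>norm (f t) \<le> \<delta>\<close> and is \<open>1\<close> where \<open>norm (f t) \<ge> 2 * \<delta>\<close>. If \<open>g\<close> has norm \<open>n\<close>, then at each point either
  \<open>(1 - \<eta>) g\<close> is zero or \<open>f\<close> is below \<open>2 * \<delta>\<close>, so \<open>n f + (1 - \<eta>) g\<close> has norm at most \<open>n (1 + 2 * \<delta>)\<close>.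
  After rotating both summands to have nonnegative values under \<open>\<psi>\<close>, the value at the first already
  uses up almost all of \<open>n M\<close>, which leaves little for the second.
\<close>

lemma functional_concentrated_on_compact:
  fixes sY :: "'k::real_or_complex_field \<Rightarrow> 'y::real_normed_vector \<Rightarrow> 'y" and \<tau> :: "'a topology"
  assumes "normed_scaling sY"
    and \<psi>: "\<psi> \<in> dual (pointwise_scale sY) (vanishing \<tau>) sup_norm" and e: "e > 0"
  obtains \<eta> :: "'a \<Rightarrow> real" and K where "continuous_map \<tau> euclideanreal \<eta>" "\<And>t. 0 \<le> \<eta> t \<and> \<eta> t \<le> 1"
    "compactin \<tau> K" "\<And>t. t \<in> topspace \<tau> \<Longrightarrow> t \<notin> K \<Longrightarrow> \<eta> t = 0"
    "\<And>g. g \<in> vanishing \<tau> \<Longrightarrow> norm (\<psi> (\<lambda>t. (1 - \<eta> t) *\<^sub>R g t)) \<le> e * sup_norm g"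
proof -
  interpret Y: normed_scaling sY by fact
  interpret C: normed_carrier "pointwise_scale sY" "vanishing \<tau>" sup_norm
    by (rule normed_carrier_vanishing) fact
  define M where "M = dual_norm (vanishing \<tau>) sup_norm \<psi>"
  have M: "M \<ge> 0" unfolding M_def using \<psi> by (rule C.dual_norm_nonneg)
  obtain f where f: "f \<in> vanishing \<tau>" "sup_norm f \<le> 1" and fM: "M - e / 2 < norm (\<psi> f)"
    using C.dual_norm_approx[OF \<psi>, of "e / 2"] e by (auto simp: M_def unit_ball_def)
  have f1: "norm (f t) \<le> 1" for t
    using norm_le_sup_norm[OF f(1), of t] f(2) by linarith
  define \<delta> where "\<delta> = e / (4 * (M + 1))"
  have \<delta>: "\<delta> > 0" "2 * \<delta> * M \<le> e / 2"
    using e M by (auto simp: \<delta>_def field_simps)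
  define \<eta> where "\<eta> t = max 0 (min 1 (norm (f t) / \<delta> - 1))" for t
  define K where "K = {t \<in> topspace \<tau>. \<delta> \<le> norm (f t)}"
  have \<eta>01: "0 \<le> \<eta> t \<and> \<eta> t \<le> 1" for t by (auto simp: \<eta>_def)
  have \<eta>_cont: "continuous_map \<tau> euclideanreal \<eta>"
  proof -
    have "continuous_map \<tau> euclidean f"
      using f(1) by (simp add: vanishing_def)
    then show ?thesis
      unfolding \<eta>_def using \<delta>(1) by (intro continuous_intros) auto
  qed
  show thesis
  proof (rule that[OF \<eta>_cont \<eta>01])
    show "compactin \<tau> K" using f(1) \<delta>(1) by (simp add: K_def vanishing_def)
    show "\<eta> t = 0" if "t \<in> topspace \<tau>" "t \<notin> K" for t
    proof -
      have "norm (f t) / \<delta> < 1" using that \<delta>(1) by (simp add: K_def)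
      then show ?thesis by (simp add: \<eta>_def)
    qed
    show "norm (\<psi> (\<lambda>t. (1 - \<eta> t) *\<^sub>R g t)) \<le> e * sup_norm g" if g: "g \<in> vanishing \<tau>" for g
    proof -
      define n where "n = sup_norm g"
      have n: "n \<ge> 0" unfolding n_def using g by (rule C.N_nonneg)
      define g' where "g' = (\<lambda>t. (1 - \<eta> t) *\<^sub>R g t)"
      have "continuous_map \<tau> euclideanreal (\<lambda>t. 1 - \<eta> t)"
        using \<eta>_cont by (intro continuous_intros)
      moreover have "\<bar>1 - \<eta> t\<bar> \<le> 1" for t using \<eta>01[of t] by auto
      ultimately have g': "g' \<in> vanishing \<tau>"
        unfolding g'_def using g by (rule vanishing_mult)
      obtain c where c: "norm c = 1" "c * \<psi> f = of_real (norm (\<psi> f))" by (rule exists_unimodular)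
      obtain b where b: "norm b = 1" "b * \<psi> g' = of_real (norm (\<psi> g'))" by (rule exists_unimodular)
      \<comment> \<open>The unimodular \<open>c\<close> and \<open>b\<close> make \<open>\<psi>\<close> nonnegative on both summands, so that their absolute values add up.\<close>
      define F where "F = pointwise_scale sY (of_real n * c) f + pointwise_scale sY b g'"
      have F: "F \<in> vanishing \<tau>"
        unfolding F_def using f(1) g' by (intro C.add_V C.scale_V)
      have "norm (F t) \<le> n * (1 + 2 * \<delta>)" for t
      proof -
        have "norm (F t) \<le> n * norm (f t) + norm (g' t)"
          using norm_triangle_ineq[of "sY (of_real n * c) (f t)" "sY b (g' t)"]
          unfolding F_def plus_fun_apply pointwise_scale_def Y.norm_scale norm_mult b(1) c(1)
          using n by simp
        also have "\<dots> = n * norm (f t) + (1 - \<eta> t) * norm (g t)"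
          using \<eta>01[of t] by (simp add: g'_def)
        also have "\<dots> \<le> n * norm (f t) + (1 - \<eta> t) * n"
          using \<eta>01[of t] norm_le_sup_norm[OF g, of t] unfolding n_def
          by (intro add_left_mono mult_left_mono) simp_all
        also have "\<dots> = n * (norm (f t) + (1 - \<eta> t))"
          by (simp add: algebra_simps)
        also have "norm (f t) + (1 - \<eta> t) \<le> 1 + 2 * \<delta>"
        proof (cases "2 * \<delta> \<le> norm (f t)")
          case True
          then have "2 \<le> norm (f t) / \<delta>" using \<delta>(1) by (simp add: pos_le_divide_eq)
          then have "\<eta> t = 1" by (simp add: \<eta>_def)
          then show ?thesis using f1[of t] \<delta>(1) by simp
        next
          case False
          then show ?thesis using \<eta>01[of t] by simp
        qed
        finally show ?thesis using n by (simp add: mult_left_mono)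
      qed
      then have F_norm: "sup_norm F \<le> n * (1 + 2 * \<delta>)" by (rule sup_norm_leI)
      have "\<psi> F = of_real n * (c * \<psi> f) + b * \<psi> g'"
        unfolding F_def using f g' C.dual_add[OF \<psi>] C.dual_scale[OF \<psi>]
        by (simp add: C.scale_V del: C.scale_scale)
      also have "\<dots> = of_real (n * norm (\<psi> f) + norm (\<psi> g'))" by (simp add: c b)
      finally have "norm (\<psi> F) = \<bar>n * norm (\<psi> f) + norm (\<psi> g')\<bar>"
        by (simp only: norm_of_real)
      then have "norm (\<psi> F) = n * norm (\<psi> f) + norm (\<psi> g')" using n by simp
      moreover have "norm (\<psi> F) \<le> M * sup_norm F"
        unfolding M_def using \<psi> F by (rule C.norm_le_dual_norm)
      moreover have "M * sup_norm F \<le> M * (n * (1 + 2 * \<delta>))"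
        using M F_norm by (intro mult_left_mono)
      ultimately have "norm (\<psi> g') \<le> n * (M - norm (\<psi> f) + 2 * \<delta> * M)"
        by (simp add: algebra_simps)
      also have "\<dots> \<le> n * e" using n fM \<delta>(2) by (intro mult_left_mono) auto
      finally show ?thesis by (simp add: g'_def n_def mult.commute)
    qed
  qed
qed

section \<open>Families of operators\<close>

text \<open>
  Hahn-Banach for the functional \<open>c x \<mapsto> c * norm x\<close> on the line through \<open>x\<close>.
\<close>

lemma norming_functional:
  assumes "normed_scaling (s :: 'k::real_or_complex_field \<Rightarrow> 'v::real_normed_vector \<Rightarrow> 'v)"
  obtains f where "f \<in> dual s UNIV norm" "\<And>y. norm (f y) \<le> norm y" "f x = of_real (norm x)"
proof -
  interpret S: normed_scaling s by fact
  interpret N: normed_carrier s UNIV norm using assms by (rule normed_carrier_UNIV)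
  \<comment> \<open>The chosen coefficient is unique for \<open>x \<noteq> 0\<close>; only the values at multiples of \<open>x\<close> matter.\<close>
  define g where "g y = (if x = 0 then 0 else (SOME c. y = s c x) * of_real (norm x))" for y
  have g: "g (s c x) = c * of_real (norm x)" for c
  proof (cases "x = 0")
    case False
    have "(SOME c'. s c x = s c' x) = c"
      by (rule some_equality) (use False in auto)
    with False show ?thesis by (simp add: g_def)
  qed (simp add: g_def)
  have span: "range (\<lambda>c. s c x) = S.span {x}" by (simp add: S.span_singleton)
  obtain f where f: "\<And>y z. y \<in> UNIV \<Longrightarrow> z \<in> UNIV \<Longrightarrow> f (y + z) = f y + f z"
      "\<And>c y. y \<in> UNIV \<Longrightarrow> f (s c y) = c * f y" "\<And>y. y \<in> UNIV \<Longrightarrow> norm (f y) \<le> norm y"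
      "\<And>y. y \<in> range (\<lambda>c. s c x) \<Longrightarrow> f y = g y"
  proof (rule N.hahn_banach_seminorm[of norm "range (\<lambda>c. s c x)" g])
    show "S.subspace (range (\<lambda>c. s c x))" unfolding span by (rule S.subspace_span)
    show "g (y + z) = g y + g z" if "y \<in> range (\<lambda>c. s c x)" "z \<in> range (\<lambda>c. s c x)" for y z
    proof -
      from that obtain a b where "y = s a x" "z = s b x" by blast
      then show ?thesis using g[of "a + b"] by (simp add: g S.scale_left_distrib algebra_simps)
    qed
    show "g (s c y) = c * g y" if "y \<in> range (\<lambda>c. s c x)" for c y
      using that by (auto simp: g)
    show "norm (g y) \<le> norm y" if "y \<in> range (\<lambda>c. s c x)" for y
      using that by (auto simp: g S.norm_scale norm_mult)
  qed (auto simp: norm_triangle_ineq S.norm_scale)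
  show thesis
  proof (rule that)
    show "f \<in> dual s UNIV norm" by (rule N.dualI[where C = 1]) (use f in auto)
    show "f x = of_real (norm x)" using f(4)[of x] g[of 1] by (metis S.scale_one mult_1 rangeI)
  qed (use f in auto)
qed

lemma eq_if_dual_eq:
  assumes "normed_scaling (s :: 'k::real_or_complex_field \<Rightarrow> 'v::real_normed_vector \<Rightarrow> 'v)"
    and eq: "\<And>f. f \<in> dual s UNIV norm \<Longrightarrow> f x = f y"
  shows "x = y"
proof -
  interpret N: normed_carrier s UNIV norm using assms(1) by (rule normed_carrier_UNIV)
  obtain f where f: "f \<in> dual s UNIV norm" "f (x - y) = of_real (norm (x - y))"
    using norming_functional[OF assms(1)] by metis
  then have "of_real (norm (x - y)) = (0::'k)"
    using eq[OF f(1)] N.dual_diff[OF f(1)] by simp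
  then show ?thesis by simp
qed

locale operator_family =
  fixes sX :: "'k::real_or_complex_field \<Rightarrow> 'x::banach \<Rightarrow> 'x"
    and sY :: "'k \<Rightarrow> 'y::banach \<Rightarrow> 'y"
    and L :: "('x \<Rightarrow>\<^sub>L 'y) set"
    and \<tau> :: "('x \<Rightarrow>\<^sub>L 'y) topology"
  assumes sX: "normed_scaling sX" and sY: "normed_scaling sY"
    and L_linear: "L \<subseteq> bounded_operators sX sY"
    and topspace_\<tau>: "topspace \<tau> = L"
    and finer: "finer_than \<tau> (subtopology strong_operator_topology L)"
begin

sublocale X: normed_scaling sX by (rule sX)
sublocale Y: normed_scaling sY by (rule sY)
sublocale XN: normed_carrier sX UNIV norm by (rule normed_carrier_UNIV) (rule sX)
sublocale YN: normed_carrier sY UNIV norm by (rule normed_carrier_UNIV) (rule sY)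
sublocale C: normed_carrier "pointwise_scale sY" "vanishing \<tau>" sup_norm
  by (rule normed_carrier_vanishing) (rule sY)

lemma apply_scale: "T \<in> L \<Longrightarrow> blinfun_apply T (sX c x) = sY c (blinfun_apply T x)"
  using L_linear by (auto simp: bounded_operators_def)

text \<open>
  The evaluation at \<open>x\<close> as an element of the function space \<open>vanishing \<tau>\<close>, hence extended by \<open>0\<close>
  where \<open>evaluation L x\<close> is undefined.
\<close>

definition hat :: "'x \<Rightarrow> ('x \<Rightarrow>\<^sub>L 'y) \<Rightarrow> 'y"
  where "hat x = (\<lambda>T. if T \<in> L then blinfun_apply T x else 0)"

lemma hat_add: "hat (x + y) = hat x + hat y"
  by (auto simp: hat_def fun_eq_iff blinfun.add_right)

lemma hat_scale: "hat (sX c x) = pointwise_scale sY c (hat x)"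
  by (auto simp: hat_def fun_eq_iff pointwise_scale_def apply_scale)

lemma continuous_map_apply: "continuous_map \<tau> euclidean (\<lambda>T. blinfun_apply T x)"
proof -
  have "continuous_map (subtopology strong_operator_topology L) euclidean (\<lambda>T. blinfun_apply T x)"
    by (intro continuous_map_from_subtopology strong_operator_topology_continuous_evaluation)
  then show ?thesis
    using finer by (auto simp: continuous_map_def finer_than_def)
qed

lemma continuous_map_hat: "continuous_map \<tau> euclidean (hat x)"
  by (rule continuous_map_eq[OF continuous_map_apply]) (simp add: hat_def topspace_\<tau>)

abbreviation E where "E \<equiv> E_space L"
abbreviation E\<^sub>0 where "E\<^sub>0 \<equiv> E0_space L \<tau>"
abbreviation NE where "NE \<equiv> E_norm L"

lemma apply_le_NE: "x \<in> E \<Longrightarrow> T \<in> L \<Longrightarrow> norm (blinfun_apply T x) \<le> NE x"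
  by (auto simp: E_space_def E_norm_def intro: cSUP_upper)

lemma E_I:
  assumes "\<And>T. T \<in> L \<Longrightarrow> norm (blinfun_apply T x) \<le> c"
  shows "x \<in> E"
  unfolding E_space_def mem_Collect_eq using assms by (rule bdd_aboveI2)

lemma NE_leI:
  assumes "\<And>T. T \<in> L \<Longrightarrow> norm (blinfun_apply T x) \<le> c" "0 \<le> c"
  shows "NE x \<le> c"
  using assms by (auto simp: E_norm_def intro: cSUP_least)

lemma NE_nonneg: "x \<in> E \<Longrightarrow> 0 \<le> NE x"
proof (cases "L = {}")
  case False
  then obtain T where "T \<in> L" by blast
  moreover assume "x \<in> E"
  ultimately show ?thesis using apply_le_NE norm_ge_zero order_trans by metis
qed (simp add: E_norm_def)

lemma normed_carrier_E: "normed_carrier sX E NE"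
proof
  have add: "norm (blinfun_apply T (x + y)) \<le> NE x + NE y" if "x \<in> E" "y \<in> E" "T \<in> L" for x y T
    using norm_triangle_ineq[of "blinfun_apply T x" "blinfun_apply T y"]
      apply_le_NE[OF that(1,3)] apply_le_NE[OF that(2,3)] by (simp add: blinfun.add_right)
  have scale: "norm (blinfun_apply T (sX c x)) \<le> norm c * NE x" if "x \<in> E" "T \<in> L" for x c T
    using apply_le_NE[OF that] that(2) by (simp add: apply_scale Y.norm_scale mult_left_mono)
  show "X.subspace E"
  proof (rule X.subspaceI)
    show "0 \<in> E" by (rule E_I[of _ 0]) simp
    show "x + y \<in> E" if "x \<in> E" "y \<in> E" for x y using add[OF that] by (rule E_I)
    show "sX c x \<in> E" if "x \<in> E" for c x using scale[OF that] by (rule E_I)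
  qed
  show "NE (x + y) \<le> NE x + NE y" if "x \<in> E" "y \<in> E" for x y
    using that add NE_nonneg by (intro NE_leI) auto
  have le: "NE (sX c x) \<le> norm c * NE x" if "x \<in> E" for c x
    using that scale NE_nonneg by (intro NE_leI) auto
  show "NE (sX c x) = norm c * NE x" if x: "x \<in> E" for c x
  proof (cases "c = 0")
    case True
    have "NE 0 \<le> 0" by (rule NE_leI) simp_all
    moreover have "0 \<le> NE 0" by (rule NE_nonneg) (rule E_I[of _ 0], simp)
    ultimately show ?thesis using True by simp
  next
    case False
    have "sX c x \<in> E" using scale[OF x] by (rule E_I)
    then have "NE (sX (inverse c) (sX c x)) \<le> norm (inverse c) * NE (sX c x)" by (rule le)
    then have "norm c * NE x \<le> NE (sX c x)" using False by (simp add: norm_divide field_simps)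
    with le[OF x] show ?thesis by (simp add: antisym)
  qed
qed

sublocale EN: normed_carrier sX E NE by (rule normed_carrier_E)

lemma E0_iff: "x \<in> E\<^sub>0 \<longleftrightarrow> x \<in> E \<and> hat x \<in> vanishing \<tau>"
proof -
  have "{T \<in> topspace \<tau>. e \<le> norm (evaluation L x T)} = {T \<in> topspace \<tau>. e \<le> norm (hat x T)}" for e
    by (auto simp: evaluation_def hat_def topspace_\<tau>)
  moreover have "evaluation L x \<in> mspace (cfunspace \<tau> euclidean_metric)" if "x \<in> E"
  proof -
    have "continuous_map \<tau> euclidean (evaluation L x)"
      by (rule continuous_map_eq[OF continuous_map_apply]) (simp add: evaluation_def topspace_\<tau>)
    moreover have "bounded (evaluation L x ` L)"
      using apply_le_NE[OF that] by (auto simp: bounded_iff evaluation_def)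
    ultimately show ?thesis
      by (simp add: mspace_cfunspace topspace_\<tau> evaluation_def)
  qed
  ultimately show ?thesis
    using continuous_map_hat
    by (auto simp: E0_space_def C0_def vanishing_def) (auto simp: hat_def topspace_\<tau>)
qed

lemma E0_subset: "E\<^sub>0 \<subseteq> E"
  by (auto simp: E0_iff)

lemma sup_norm_hat: "x \<in> E\<^sub>0 \<Longrightarrow> sup_norm (hat x) = NE x"
proof (rule antisym)
  assume x: "x \<in> E\<^sub>0"
  then show "sup_norm (hat x) \<le> NE x"
    using apply_le_NE NE_nonneg by (intro sup_norm_leI) (auto simp: hat_def E0_iff)
  show "NE x \<le> sup_norm (hat x)"
  proof (rule NE_leI)
    show "norm (blinfun_apply T x) \<le> sup_norm (hat x)" if "T \<in> L" for T
      using norm_le_sup_norm[of "hat x" \<tau> T] x that by (simp add: E0_iff hat_def)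
    show "0 \<le> sup_norm (hat x)" using x by (intro C.N_nonneg) (simp add: E0_iff)
  qed
qed

lemma subspace_E0: "X.subspace E\<^sub>0"
proof (rule X.subspaceI)
  have "hat 0 = 0" by (auto simp: hat_def fun_eq_iff)
  then show "0 \<in> E\<^sub>0" using EN.zero_V C.zero_V by (simp only: E0_iff)
qed (auto simp: E0_iff hat_add hat_scale)

sublocale E0N: normed_carrier sX E\<^sub>0 NE
proof
  show "X.subspace E\<^sub>0" by (rule subspace_E0)
  show "NE (x + y) \<le> NE x + NE y" if "x \<in> E\<^sub>0" "y \<in> E\<^sub>0" for x y
    using that E0_subset by (intro EN.N_triangle) auto
  show "NE (sX c x) = norm c * NE x" if "x \<in> E\<^sub>0" for c x
    using that E0_subset by (intro EN.N_scale) auto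
qed

text \<open>
  The uniform boundedness principle: each \<open>x\<close> has a bounded orbit since \<open>T \<mapsto> T x\<close> is continuous on
  \<open>K\<close>, and \<open>x \<mapsto> SUP T\<in>K. norm (T x)\<close> is countably subadditive as a supremum of continuous seminorms,
  so Zabreiko's lemma applies.
\<close>

lemma bounded_on_compact_operators:
  assumes K: "compactin \<tau> K"
  obtains C where "0 \<le> C" "\<And>x T. T \<in> K \<Longrightarrow> norm (blinfun_apply T x) \<le> C * norm x"
proof (cases "K = {}")
  case True
  then show ?thesis using that[of 0] by simp
next
  case False
  define p where "p x = (SUP T\<in>K. norm (blinfun_apply T x))" for x
  have bdd: "bdd_above ((\<lambda>T. norm (blinfun_apply T x)) ` K)" for x
    using bounded_on_compactin[OF continuous_map_apply K] by (metis bdd_aboveI2)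
  have upper: "norm (blinfun_apply T x) \<le> p x" if "T \<in> K" for T x
    unfolding p_def using that bdd by (intro cSUP_upper)
  have lower: "p x \<le> c" if "\<And>T. T \<in> K \<Longrightarrow> norm (blinfun_apply T x) \<le> c" for x c
    unfolding p_def using that False by (intro cSUP_least)
  obtain C where C: "0 \<le> C" "\<And>x. x \<in> UNIV \<Longrightarrow> p x \<le> C * norm x"
  proof (rule XN.countably_subadditive_imp_bounded[of p])
    show "\<exists>y\<in>UNIV. (\<lambda>n. norm (x n - y)) \<longlonglongrightarrow> 0"
      if "\<And>e. e > 0 \<Longrightarrow> \<exists>M. \<forall>m\<ge>M. \<forall>n\<ge>M. norm (x m - x n) < e" for x :: "nat \<Rightarrow> 'x"
    proof -
      have "Cauchy x" using that by (rule CauchyI)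
      then obtain y where "x \<longlonglongrightarrow> y" using Cauchy_convergent convergent_def by blast
      then show ?thesis by (auto simp: tendsto_norm_zero_iff LIM_zero_iff)
    qed
    show "p (x - y) \<le> p x + p y" for x y
    proof (rule lower)
      show "norm (blinfun_apply T (x - y)) \<le> p x + p y" if "T \<in> K" for T
        using norm_triangle_ineq4[of "blinfun_apply T x" "blinfun_apply T y"] upper[OF that, of x]
          upper[OF that, of y] by (simp add: blinfun.diff_right)
    qed
    have le: "p (r *\<^sub>R x) \<le> r * p x" if "0 \<le> r" for r x
      using upper that by (intro lower) (simp add: blinfun.scaleR_right mult_left_mono)
    have nonneg: "0 \<le> p x" for x using False upper norm_ge_zero order_trans by blast
    then show "0 \<le> p x" for x .
    show "p (sX (of_real t) x) = t * p x" if "0 \<le> t" for t x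
    proof (cases "t = 0")
      case True
      then show ?thesis using le[of 0 x] nonneg[of 0] by (simp add: X.scale_of_real)
    next
      case t: False
      then have "p x \<le> inverse t * p (t *\<^sub>R x)" using le[of "inverse t" "t *\<^sub>R x"] that by simp
      then show ?thesis using le[of t x] t that by (simp add: X.scale_of_real field_simps)
    qed
    show "p y \<le> (\<Sum>k. p (x k))"
      if lim: "(\<lambda>n. norm ((\<Sum>k<n. x k) - y)) \<longlonglongrightarrow> 0" and summ: "summable (\<lambda>k. p (x k))"
      for x :: "nat \<Rightarrow> 'x" and y
    proof (rule lower)
      fix T assume T: "T \<in> K"
      have "(\<lambda>n. \<Sum>k<n. x k) \<longlonglongrightarrow> y" using lim by (simp add: tendsto_norm_zero_iff LIM_zero_iff)
      then have "(\<lambda>n. norm (blinfun_apply T (\<Sum>k<n. x k))) \<longlonglongrightarrow> norm (blinfun_apply T y)"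
        by (intro tendsto_intros)
      moreover have "norm (blinfun_apply T (\<Sum>k<n. x k)) \<le> (\<Sum>k. p (x k))" for n
      proof -
        have "norm (blinfun_apply T (\<Sum>k<n. x k)) \<le> (\<Sum>k<n. norm (blinfun_apply T (x k)))"
          by (simp add: blinfun.sum_right norm_sum)
        also have "\<dots> \<le> (\<Sum>k<n. p (x k))" using upper[OF T] by (intro sum_mono)
        also have "\<dots> \<le> (\<Sum>k. p (x k))" using summ nonneg by (intro sum_le_suminf) auto
        finally show ?thesis .
      qed
      ultimately show "norm (blinfun_apply T y) \<le> (\<Sum>k. p (x k))"
        by (intro LIMSEQ_le_const2) auto
    qed
  qed auto
  then show ?thesis using upper order_trans by (intro that[of C]) blast+
qed

end

section \<open>Density of the restrictions of functionals\<close>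

text \<open>
  The real part maps Cauchy sequences to Cauchy sequences, and a scalar is recovered continuously from
  real parts, so completeness is inherited from the reals.
\<close>

lemma Cauchy_scalar_convergent:
  fixes z :: "nat \<Rightarrow> 'k::real_or_complex_field"
  assumes "Cauchy z"
  shows "convergent z"
proof -
  obtain \<rho> :: "'k \<Rightarrow> real" and j where add: "\<And>z w. \<rho> (z + w) = \<rho> z + \<rho> w"
    and bound: "\<And>z. \<bar>\<rho> z\<bar> \<le> norm z"
    and rec: "\<And>z. z = of_real (\<rho> z) - j * of_real (\<rho> (j * z))"
    using scalar_reconstruction[where 'k='k] by blast
  have conv: "convergent (\<lambda>n. \<rho> (w n))" if "Cauchy w" for w :: "nat \<Rightarrow> 'k"
  proof (rule Cauchy_convergent, rule CauchyI)
    fix e :: real assume "e > 0"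
    then obtain M where M: "\<forall>m\<ge>M. \<forall>n\<ge>M. norm (w m - w n) < e"
      using CauchyD[OF \<open>Cauchy w\<close>] by blast
    have "norm (\<rho> (w m) - \<rho> (w n)) \<le> norm (w m - w n)" for m n
      using bound[of "w m - w n"] add[of "w m - w n" "w n"] by simp
    then show "\<exists>M. \<forall>m\<ge>M. \<forall>n\<ge>M. norm (\<rho> (w m) - \<rho> (w n)) < e"
      using M by (meson le_less_trans)
  qed
  have "Cauchy (\<lambda>n. j * z n)"
    using bounded_linear.Cauchy[OF bounded_linear_mult_right assms] .
  then obtain a b where ab: "(\<lambda>n. \<rho> (z n)) \<longlonglongrightarrow> a" "(\<lambda>n. \<rho> (j * z n)) \<longlonglongrightarrow> b"
    using conv[of z] conv[of "\<lambda>n. j * z n"] assms by (auto simp: convergent_def)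
  have "(\<lambda>n. of_real (\<rho> (z n)) - j * of_real (\<rho> (j * z n))) \<longlonglongrightarrow> of_real a - j * of_real b"
    by (intro tendsto_intros ab)
  then show ?thesis unfolding rec[symmetric] by (rule convergentI)
qed

locale complete_operator_family = operator_family sX sY L \<tau>
  for sX :: "'k::real_or_complex_field \<Rightarrow> 'x::banach \<Rightarrow> 'x"
    and sY :: "'k \<Rightarrow> 'y::banach \<Rightarrow> 'y" and L \<tau> +
  assumes inj: "inj_on (evaluation L) (E_space L)"
    and closed: "closedin (mtopology_of (cfunspace \<tau> euclidean_metric)) (evaluation L ` E_space L)"
begin

lemma E_eqI:
  assumes "x \<in> E" "y \<in> E" "\<And>T. T \<in> L \<Longrightarrow> blinfun_apply T x = blinfun_apply T y"
  shows "x = y"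
proof (rule inj_onD[OF inj _ assms(1,2)])
  show "evaluation L x = evaluation L y"
    using assms(3) by (auto simp: evaluation_def restrict_def fun_eq_iff)
qed

lemma NE_definite: "x \<in> E \<Longrightarrow> NE x = 0 \<Longrightarrow> x = 0"
  by (rule E_eqI) (use apply_le_NE EN.zero_V in fastforce)+

text \<open>
  Evaluation embeds \<open>E\<close> isometrically onto a closed subset of the complete space of bounded continuous
  functions.
\<close>

lemma E_complete:
  assumes x: "\<And>n. x n \<in> E"
    and Cauchy: "\<And>e. e > 0 \<Longrightarrow> \<exists>M. \<forall>m\<ge>M. \<forall>n\<ge>M. NE (x m - x n) < e"
  shows "\<exists>y\<in>E. (\<lambda>n. NE (x n - y)) \<longlonglongrightarrow> 0"
proof -
  define m :: "(('x \<Rightarrow>\<^sub>L 'y) \<Rightarrow> 'y) metric" where "m = cfunspace \<tau> euclidean_metric"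
  interpret F: Metric_space "mspace m" "mdist m" by (rule Metric_space_mspace_mdist)
  have top: "mtopology_of m = F.mtopology" by (simp add: mtopology_of_def)
  have closedF: "closedin F.mtopology (evaluation L ` E)"
    using closed by (simp only: m_def[symmetric] top)
  then have sub: "evaluation L ` E \<subseteq> mspace m"
    using closedin_subset by fastforce
  have "Met_TC.mcomplete TYPE('y)"
    by (simp add: mcomplete_iff_complete complete_UNIV)
  then have "mcomplete_of m"
    unfolding m_def euclidean_metric_def by (rule Met_TC.mcomplete_cfunspace[unfolded Met_TC.Self_def])
  then have "F.mcomplete" by (simp add: mcomplete_of_def)
  moreover have "F.MCauchy (\<lambda>n. evaluation L (x n))"
    unfolding F.MCauchy_def
  proof (intro conjI allI impI)
    show "range (\<lambda>n. evaluation L (x n)) \<subseteq> mspace m" using sub x by blast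
    fix e :: real assume "e > 0"
    then obtain M where M: "\<And>i j. i \<ge> M \<Longrightarrow> j \<ge> M \<Longrightarrow> NE (x i - x j) < e" using Cauchy by blast
    have "mdist m (evaluation L (x i)) (evaluation L (x j)) \<le> NE (x i - x j)" for i j
      unfolding m_def
    proof (rule mdist_cfunspace_le)
      show "0 \<le> NE (x i - x j)" using x by (intro NE_nonneg EN.diff_V)
      show "mdist euclidean_metric (evaluation L (x i) T) (evaluation L (x j) T) \<le> NE (x i - x j)"
        if "T \<in> topspace \<tau>" for T
        using that apply_le_NE[of "x i - x j" T] x
        by (simp add: evaluation_def topspace_\<tau> dist_norm blinfun.diff_right EN.diff_V)
    qed
    then show "\<exists>N. \<forall>n n'. N \<le> n \<longrightarrow> N \<le> n' \<longrightarrow>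
        mdist m (evaluation L (x n)) (evaluation L (x n')) < e"
      using M by (meson le_less_trans)
  qed
  ultimately obtain g where g: "limitin F.mtopology (\<lambda>n. evaluation L (x n)) g sequentially"
    unfolding F.mcomplete_def by blast
  then have "g \<in> evaluation L ` E"
    by (rule limitin_closedin) (use closedF x in auto)
  then obtain y where y: "y \<in> E" "g = evaluation L y" by blast
  have "(\<lambda>n. NE (x n - y)) \<longlonglongrightarrow> 0"
  proof (rule LIMSEQ_I)
    fix e :: real assume "e > 0"
    then obtain n0 where n0: "\<And>n. n \<ge> n0 \<Longrightarrow> mdist m (evaluation L (x n)) (evaluation L y) < e"
      using g unfolding F.limit_metric_sequentially y(2) by blast
    have "NE (x n - y) \<le> mdist m (evaluation L (x n)) (evaluation L y)" for n
    proof (rule NE_leI)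
      fix T assume T: "T \<in> L"
      have "mdist euclidean_metric (evaluation L (x n) T) (evaluation L y T) \<le>
          mdist m (evaluation L (x n)) (evaluation L y)"
      proof (rule mdist_cfunspace_imp_mdist_le[where X = \<tau> and m = euclidean_metric
            and f = "evaluation L (x n)" and g = "evaluation L y", folded m_def])
        show "evaluation L (x n) \<in> mspace m" "evaluation L y \<in> mspace m"
          using sub x y(1) by blast+
        show "T \<in> topspace \<tau>" using T topspace_\<tau> by simp
      qed simp
      then show "norm (blinfun_apply T (x n - y)) \<le> mdist m (evaluation L (x n)) (evaluation L y)"
        using T by (simp add: evaluation_def dist_norm blinfun.diff_right)
    qed simp
    moreover have "0 \<le> NE (x n - y)" for n using x y by (intro NE_nonneg EN.diff_V)
    ultimately show "\<exists>n0. \<forall>n\<ge>n0. norm (NE (x n - y) - 0) < e"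
      using n0 by (intro exI[of _ n0]) (simp, meson le_less_trans)
  qed
  with y(1) show ?thesis by blast
qed

text \<open>
  The closed graph theorem for the inclusion of \<open>E\<close> in \<open>X\<close>, obtained from Zabreiko's lemma for the norm
  of \<open>X\<close>. If a series converges to \<open>y\<close> in \<open>E\<close> and absolutely to \<open>z\<close> in \<open>X\<close>, then \<open>T y = T z\<close> for all
  operators of the family, hence \<open>y = z\<close> by injectivity of the evaluation.
\<close>

lemma inclusion_bounded:
  obtains C where "0 \<le> C" "\<And>x. x \<in> E \<Longrightarrow> norm x \<le> C * NE x"
proof (rule EN.countably_subadditive_imp_bounded[of norm])
  show "norm y \<le> (\<Sum>k. norm (x k))"
    if x: "\<And>k. x k \<in> E" and y: "y \<in> E" and lim: "(\<lambda>n. NE ((\<Sum>k<n. x k) - y)) \<longlonglongrightarrow> 0"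
      and summ: "summable (\<lambda>k. norm (x k))" for x :: "nat \<Rightarrow> 'x" and y
  proof -
    define z where "z = (\<Sum>k. x k)"
    have z: "(\<lambda>n. \<Sum>k<n. x k) \<longlonglongrightarrow> z"
      unfolding z_def using summable_norm_cancel[OF summ] by (rule summable_LIMSEQ)
    have sumE: "(\<Sum>k<n. x k) \<in> E" for n
      by (rule X.subspace_sum[OF EN.subspace_V]) (rule x)
    have Tz: "blinfun_apply T z = blinfun_apply T y" if T: "T \<in> L" for T
    proof (rule LIMSEQ_unique)
      show "(\<lambda>n. blinfun_apply T (\<Sum>k<n. x k)) \<longlonglongrightarrow> blinfun_apply T z"
        using z by (intro tendsto_intros)
      have "norm (blinfun_apply T (\<Sum>k<n. x k) - blinfun_apply T y) \<le> NE ((\<Sum>k<n. x k) - y)" for n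
        using apply_le_NE[OF EN.diff_V[OF sumE y] T] by (simp add: blinfun.diff_right)
      then have "(\<lambda>n. blinfun_apply T (\<Sum>k<n. x k) - blinfun_apply T y) \<longlonglongrightarrow> 0"
        using lim by (intro Lim_null_comparison[OF _ lim]) auto
      then show "(\<lambda>n. blinfun_apply T (\<Sum>k<n. x k)) \<longlonglongrightarrow> blinfun_apply T y"
        by (simp add: LIM_zero_iff)
    qed
    then have "z \<in> E" using apply_le_NE[OF y] by (intro E_I[of _ "NE y"]) simp
    with Tz y have "y = z" by (intro E_eqI) auto
    then show ?thesis unfolding z_def using summ by (simp add: summable_norm)
  qed
qed (use NE_definite E_complete norm_triangle_ineq4 that in \<open>auto simp: X.scale_of_real\<close>)

lemma J_op_apply: "J_op L \<tau> f x = (if x \<in> E\<^sub>0 then f x else 0)"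
  by (simp add: J_op_def adjoint_on_def)

text \<open>
  Restrictions of functionals are bounded on \<open>E\<^sub>0\<close> because the inclusion into \<open>X\<close> is.
\<close>

lemma J_op_bounded:
  obtains C where "0 \<le> C" "\<And>f :: 'x \<Rightarrow> 'k. f \<in> dual sX UNIV norm \<Longrightarrow>
    J_op L \<tau> f \<in> dual sX E\<^sub>0 NE \<and> dual_norm E\<^sub>0 NE (J_op L \<tau> f) \<le> C * dual_norm UNIV norm f"
proof -
  obtain C where C: "0 \<le> C" "\<And>x. x \<in> E \<Longrightarrow> norm x \<le> C * NE x" by (rule inclusion_bounded) blast
  show thesis
  proof (rule that[OF C(1)])
    fix f :: "'x \<Rightarrow> 'k" assume f: "f \<in> dual sX UNIV norm"
    let ?M = "dual_norm UNIV norm f"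
    have M: "0 \<le> ?M" using f by (rule XN.dual_norm_nonneg)
    have le: "norm (J_op L \<tau> f x) \<le> (C * ?M) * NE x" if x: "x \<in> E\<^sub>0" for x
    proof -
      have "norm (f x) \<le> ?M * norm x" using f by (rule XN.norm_le_dual_norm) simp
      also have "\<dots> \<le> ?M * (C * NE x)" using C(2) x E0_subset M by (intro mult_left_mono) auto
      finally show ?thesis using x by (simp add: J_op_apply mult_ac)
    qed
    have "J_op L \<tau> f \<in> dual sX E\<^sub>0 NE"
      by (rule E0N.dualI[OF _ _ le])
        (auto simp: J_op_apply XN.dual_add[OF f] XN.dual_scale[OF f] E0N.add_V E0N.scale_V)
    moreover have "dual_norm E\<^sub>0 NE (J_op L \<tau> f) \<le> C * ?M"
      using le M C(1) by (intro E0N.dual_norm_leI) auto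
    ultimately show "J_op L \<tau> f \<in> dual sX E\<^sub>0 NE \<and> dual_norm E\<^sub>0 NE (J_op L \<tau> f) \<le> C * ?M" ..
  qed
qed

lemma J_op_in_dual: "f \<in> dual sX UNIV norm \<Longrightarrow> J_op L \<tau> f \<in> dual sX E\<^sub>0 NE"
  using J_op_bounded by metis

text \<open>
  Extend \<open>\<phi>\<close> to \<open>\<psi>\<close> on the functions vanishing at infinity, concentrate \<open>\<psi>\<close> on a compact set \<open>K\<close> by a
  cutoff \<open>\<eta>\<close>, and take \<open>f x = \<psi> (\<eta> * hat x)\<close>. The product \<open>\<eta> * hat x\<close> vanishes off \<open>K\<close>, so it belongs
  to the space for every \<open>x\<close> in \<open>X\<close>, and uniform boundedness on \<open>K\<close> bounds it by the norm of \<open>x\<close>.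
\<close>

lemma J_op_dense_range:
  assumes \<phi>: "\<phi> \<in> dual sX E\<^sub>0 NE" and e: "e > 0"
  obtains f where "f \<in> dual sX UNIV norm" "\<And>x. x \<in> E\<^sub>0 \<Longrightarrow> norm (\<phi> x - f x) \<le> e * NE x"
proof -
  define M where "M = dual_norm E\<^sub>0 NE \<phi>"
  have M: "0 \<le> M" unfolding M_def using \<phi> by (rule E0N.dual_norm_nonneg)
  have "inj_on hat E\<^sub>0"
  proof (rule inj_onI)
    fix x y assume xy: "x \<in> E\<^sub>0" "y \<in> E\<^sub>0" "hat x = hat y"
    show "x = y"
    proof (rule E_eqI)
      show "blinfun_apply T x = blinfun_apply T y" if "T \<in> L" for T
        using fun_cong[OF xy(3), of T] that by (simp add: hat_def)
    qed (use xy E0_subset in auto)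
  qed
  then have inv: "inv_into E\<^sub>0 hat (hat x) = x" if "x \<in> E\<^sub>0" for x
    using that by (rule inv_into_f_f)
  let ?U = "hat ` E\<^sub>0"
  obtain g where g: "\<And>u v. u \<in> vanishing \<tau> \<Longrightarrow> v \<in> vanishing \<tau> \<Longrightarrow> g (u + v) = g u + g v"
      "\<And>c u. u \<in> vanishing \<tau> \<Longrightarrow> g (pointwise_scale sY c u) = c * g u"
      "\<And>u. u \<in> vanishing \<tau> \<Longrightarrow> norm (g u) \<le> M * sup_norm u"
      "\<And>u. u \<in> ?U \<Longrightarrow> g u = \<phi> (inv_into E\<^sub>0 hat u)"
  proof (rule C.hahn_banach_seminorm[of "\<lambda>u. M * sup_norm u" ?U "\<lambda>u. \<phi> (inv_into E\<^sub>0 hat u)"])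
    show "M * sup_norm (u + v) \<le> M * sup_norm u + M * sup_norm v"
      if "u \<in> vanishing \<tau>" "v \<in> vanishing \<tau>" for u v :: "('x \<Rightarrow>\<^sub>L 'y) \<Rightarrow> 'y"
      using mult_left_mono[OF C.N_triangle[OF that] M] by (simp add: distrib_left)
    show "M * sup_norm (pointwise_scale sY c u) = norm c * (M * sup_norm u)"
      if "u \<in> vanishing \<tau>" for c u
      using C.N_scale[OF that] by simp
    show "C.subspace ?U"
    proof (rule C.subspaceI)
      have "hat 0 = 0" by (auto simp: hat_def fun_eq_iff)
      then show "0 \<in> ?U" using E0N.zero_V by (metis imageI)
    qed (auto simp: hat_add[symmetric] hat_scale[symmetric])
    show "?U \<subseteq> vanishing \<tau>" by (auto simp: E0_iff)
    show "\<phi> (inv_into E\<^sub>0 hat (u + v)) = \<phi> (inv_into E\<^sub>0 hat u) + \<phi> (inv_into E\<^sub>0 hat v)"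
      if "u \<in> ?U" "v \<in> ?U" for u v
      using that E0N.dual_add[OF \<phi>] by (auto simp: hat_add[symmetric] inv E0N.add_V)
    show "\<phi> (inv_into E\<^sub>0 hat (pointwise_scale sY c u)) = c * \<phi> (inv_into E\<^sub>0 hat u)"
      if "u \<in> ?U" for c u
      using that E0N.dual_scale[OF \<phi>] by (auto simp: hat_scale[symmetric] inv E0N.scale_V)
    show "norm (\<phi> (inv_into E\<^sub>0 hat u)) \<le> M * sup_norm u" if "u \<in> ?U" for u
      using that E0N.norm_le_dual_norm[OF \<phi>] by (auto simp: inv sup_norm_hat M_def)
  qed blast
  have g_hat: "g (hat x) = \<phi> x" if "x \<in> E\<^sub>0" for x
    using g(4)[of "hat x"] that inv by simp
  define \<psi> where "\<psi> u = (if u \<in> vanishing \<tau> then g u else 0)" for u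
  have "\<psi> \<in> dual (pointwise_scale sY) (vanishing \<tau>) sup_norm"
    by (rule C.dualI[where C = M]) (use g C.add_V C.scale_V in \<open>auto simp: \<psi>_def\<close>)
  from sY this e obtain \<eta> K where \<eta>: "continuous_map \<tau> euclideanreal \<eta>" "\<And>t. 0 \<le> \<eta> t \<and> \<eta> t \<le> 1"
    and K: "compactin \<tau> K" "\<And>t. t \<in> topspace \<tau> \<Longrightarrow> t \<notin> K \<Longrightarrow> \<eta> t = 0"
    and small: "\<And>u. u \<in> vanishing \<tau> \<Longrightarrow> norm (\<psi> (\<lambda>t. (1 - \<eta> t) *\<^sub>R u t)) \<le> e * sup_norm u"
    by (rule functional_concentrated_on_compact) blast
  obtain C where C: "0 \<le> C" "\<And>x T. T \<in> K \<Longrightarrow> norm (blinfun_apply T x) \<le> C * norm x"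
    by (rule bounded_on_compact_operators[OF K(1)]) blast
  define cut where "cut x = (\<lambda>T. \<eta> T *\<^sub>R hat x T)" for x
  have cut: "cut x \<in> vanishing \<tau>" for x
    unfolding cut_def using \<eta>(1) K(1,2) continuous_map_hat
    by (rule vanishing_cutoff) (simp_all add: hat_def topspace_\<tau>)
  have cut_norm: "sup_norm (cut x) \<le> C * norm x" for x
  proof (rule sup_norm_leI)
    fix T
    have pos: "0 \<le> C * norm x" using C(1) by simp
    show "norm (cut x T) \<le> C * norm x"
    proof (cases "T \<in> K")
      case True
      have "norm (cut x T) \<le> 1 * norm (hat x T)"
        unfolding cut_def norm_scaleR using \<eta>(2)[of T] by (intro mult_right_mono) auto
      also have "\<dots> \<le> C * norm x" using C(2)[OF True] pos by (simp add: hat_def)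
      finally show ?thesis .
    next
      case False
      then have "cut x T = 0" using K(2)[of T] by (auto simp: cut_def hat_def topspace_\<tau>)
      then show ?thesis using pos by simp
    qed
  qed
  show thesis
  proof (rule that[of "\<lambda>x. g (cut x)"])
    have cut_add: "cut (x + y) = cut x + cut y" for x y
      by (simp add: cut_def fun_eq_iff hat_add scaleR_right_distrib)
    have cut_scale: "cut (sX c x) = pointwise_scale sY c (cut x)" for c x
      by (simp add: cut_def fun_eq_iff hat_scale pointwise_scale_def
          linear_cmul[OF bounded_linear.linear[OF Y.bounded_linear_scale]])
    show "(\<lambda>x. g (cut x)) \<in> dual sX UNIV norm"
    proof (rule XN.dualI[where C = "M * C"])
      show "norm (g (cut x)) \<le> M * C * norm x" for x
        using order_trans[OF g(3)[OF cut] mult_left_mono[OF cut_norm M]] by (simp add: mult.assoc)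
    qed (use cut g(1,2) in \<open>auto simp: cut_add cut_scale\<close>)
    show "norm (\<phi> x - g (cut x)) \<le> e * NE x" if x: "x \<in> E\<^sub>0" for x
    proof -
      have hx: "hat x \<in> vanishing \<tau>" using x by (simp add: E0_iff)
      let ?r = "\<lambda>t. (1 - \<eta> t) *\<^sub>R hat x t"
      have r: "?r = hat x - cut x" by (simp add: cut_def fun_eq_iff scaleR_left_diff_distrib)
      have rv: "?r \<in> vanishing \<tau>" unfolding r using hx cut by (rule C.diff_V)
      have "?r + cut x = hat x" by (simp add: r)
      then have "\<phi> x = g ?r + g (cut x)" using g(1)[OF rv cut] g_hat[OF x] by metis
      then have "\<phi> x - g (cut x) = \<psi> ?r" using rv by (simp add: \<psi>_def)
      then show ?thesis using small[OF hx] sup_norm_hat[OF x] by simp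
    qed
  qed
qed

end

section \<open>The bidual of the small space\<close>

locale biduality_setting = complete_operator_family sX sY L \<tau>
  for sX :: "'k::real_or_complex_field \<Rightarrow> 'x::banach \<Rightarrow> 'x"
    and sY :: "'k \<Rightarrow> 'y::banach \<Rightarrow> 'y" and L \<tau> +
  assumes reflexive: "reflexive sX UNIV norm"
    and dense: "unit_ball (E_space L) (E_norm L) \<subseteq> closure (unit_ball (E0_space L \<tau>) (E_norm L))"
begin

sublocale DX: normed_carrier fun_scale "dual sX UNIV norm" "dual_norm UNIV norm"
  by (rule XN.normed_carrier_dual)

sublocale D0: normed_carrier fun_scale "dual sX E\<^sub>0 NE" "dual_norm E\<^sub>0 NE"
  by (rule E0N.normed_carrier_dual)

sublocale DD0: normed_carrier fun_scale "bidual sX E\<^sub>0 NE" "bidual_norm sX E\<^sub>0 NE"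
  unfolding bidual_def bidual_norm_def by (rule D0.normed_carrier_dual)

abbreviation J where "J \<equiv> J_op L \<tau> :: ('x \<Rightarrow> 'k) \<Rightarrow> 'x \<Rightarrow> 'k"
abbreviation I where "I \<equiv> I_op sX L \<tau>"

lemma bidual_dual: "\<Phi> \<in> bidual sX E\<^sub>0 NE \<Longrightarrow> \<Phi> \<in> dual fun_scale (dual sX E\<^sub>0 NE) (dual_norm E\<^sub>0 NE)"
  by (simp add: bidual_def)

text \<open>
  The adjoint of \<open>J\<close> maps \<open>\<Phi>\<close> into the bidual of \<open>X\<close>. By reflexivity the image is the evaluation at
  a vector, which is \<open>I \<Phi>\<close>.
\<close>

lemma I_op_apply:
  assumes \<Phi>: "\<Phi> \<in> bidual sX E\<^sub>0 NE" and f: "f \<in> dual sX UNIV norm"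
  shows "f (I \<Phi>) = \<Phi> (J f)"
proof -
  note \<Phi>' = bidual_dual[OF \<Phi>]
  let ?\<Psi> = "adjoint_on (dual sX UNIV norm) J \<Phi>"
  obtain C where C: "0 \<le> C" "\<And>f :: 'x \<Rightarrow> 'k. f \<in> dual sX UNIV norm \<Longrightarrow>
      J f \<in> dual sX E\<^sub>0 NE \<and> dual_norm E\<^sub>0 NE (J f) \<le> C * dual_norm UNIV norm f"
    using J_op_bounded by blast
  have J_add: "J (f + g) = J f + J g" for f g by (simp add: J_op_apply fun_eq_iff)
  have J_scale: "J (fun_scale c f) = fun_scale c (J f)" for c f
    by (simp add: J_op_apply fun_eq_iff fun_scale_def)
  have "?\<Psi> \<in> dual fun_scale (dual sX UNIV norm) (dual_norm UNIV norm)"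
  proof (rule DX.dualI[where C = "bidual_norm sX E\<^sub>0 NE \<Phi> * C"])
    show "?\<Psi> (f + g) = ?\<Psi> f + ?\<Psi> g" if "f \<in> dual sX UNIV norm" "g \<in> dual sX UNIV norm" for f g
      using that DX.add_V[OF that] D0.dual_add[OF \<Phi>', of "J f" "J g"] C(2)
      by (simp add: adjoint_on_def J_add)
    show "?\<Psi> (fun_scale c f) = c * ?\<Psi> f" if "f \<in> dual sX UNIV norm" for c f
      using that DX.scale_V[OF that] D0.dual_scale[OF \<Phi>', of "J f"] C(2)
      by (simp add: adjoint_on_def J_scale)
    show "norm (?\<Psi> f) \<le> bidual_norm sX E\<^sub>0 NE \<Phi> * C * dual_norm UNIV norm f"
      if f: "f \<in> dual sX UNIV norm" for f
    proof -
      have "norm (\<Phi> (J f)) \<le> bidual_norm sX E\<^sub>0 NE \<Phi> * dual_norm E\<^sub>0 NE (J f)"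
        unfolding bidual_norm_def using C(2)[OF f] by (intro D0.norm_le_dual_norm[OF \<Phi>']) simp
      also have "\<dots> \<le> bidual_norm sX E\<^sub>0 NE \<Phi> * (C * dual_norm UNIV norm f)"
        using C(2)[OF f] DD0.N_nonneg[OF \<Phi>] by (intro mult_left_mono) auto
      finally show ?thesis using f by (simp add: adjoint_on_def mult.assoc)
    qed
  qed (simp add: adjoint_on_def)
  then have "?\<Psi> \<in> canonical_embedding sX UNIV norm ` UNIV"
    using reflexive by (simp only: reflexive_def bidual_def)
  then have "canonical_embedding sX UNIV norm (I \<Phi>) = ?\<Psi>"
    unfolding I_op_def by (rule f_inv_into_f)
  from fun_cong[OF this, of f] f show ?thesis
    by (simp add: canonical_embedding_def adjoint_on_def)
qed

lemma I_op_eqI: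
  assumes "\<Phi> \<in> bidual sX E\<^sub>0 NE" "\<And>f. f \<in> dual sX UNIV norm \<Longrightarrow> \<Phi> (J f) = f x"
  shows "I \<Phi> = x"
proof (rule eq_if_dual_eq[OF sX])
  show "f (I \<Phi>) = f x" if "f \<in> dual sX UNIV norm" for f
    using I_op_apply[OF assms(1) that] assms(2)[OF that] by (rule trans)
qed

text \<open>
  \<open>\<Phi>\<close> is continuous and vanishes on the range of \<open>J\<close>, which is dense in the dual of \<open>E\<^sub>0\<close>.
\<close>

lemma bidual_eq_zeroI:
  assumes \<Phi>: "\<Phi> \<in> bidual sX E\<^sub>0 NE" and zero: "\<And>f. f \<in> dual sX UNIV norm \<Longrightarrow> \<Phi> (J f) = 0"
  shows "\<Phi> = 0"
proof
  fix \<phi>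
  note \<Phi>' = bidual_dual[OF \<Phi>]
  let ?M = "bidual_norm sX E\<^sub>0 NE \<Phi>"
  have M: "0 \<le> ?M" using \<Phi> by (rule DD0.N_nonneg)
  show "\<Phi> \<phi> = 0 \<phi>"
  proof (cases "\<phi> \<in> dual sX E\<^sub>0 NE")
    case True
    have bound: "norm (\<Phi> \<phi>) \<le> ?M * e" if e: "e > 0" for e
    proof -
      obtain f where f: "f \<in> dual sX UNIV norm" "\<And>x. x \<in> E\<^sub>0 \<Longrightarrow> norm (\<phi> x - f x) \<le> e * NE x"
        by (rule J_op_dense_range[OF True e]) blast
      have Jf: "J f \<in> dual sX E\<^sub>0 NE" using f(1) by (rule J_op_in_dual)
      have "dual_norm E\<^sub>0 NE (\<phi> - J f) \<le> e"
        using f(2) e by (intro E0N.dual_norm_leI) (auto simp: J_op_apply)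
      moreover have "\<Phi> \<phi> = \<Phi> (\<phi> - J f)"
        using D0.dual_diff[OF \<Phi>' True Jf] zero[OF f(1)] by simp
      moreover have "norm (\<Phi> (\<phi> - J f)) \<le> ?M * dual_norm E\<^sub>0 NE (\<phi> - J f)"
        unfolding bidual_norm_def using True Jf by (intro D0.norm_le_dual_norm[OF \<Phi>'] D0.diff_V)
      ultimately show ?thesis using M by (metis mult_left_mono order_trans)
    qed
    have "norm (\<Phi> \<phi>) \<le> 0 + e" if e: "e > 0" for e
    proof -
      have "norm (\<Phi> \<phi>) \<le> ?M * (e / (?M + 1))" using e M by (intro bound) simp
      also have "\<dots> \<le> e" using e M by (simp add: field_simps)
      finally show ?thesis by simp
    qed
    then have "norm (\<Phi> \<phi>) \<le> 0" by (rule field_le_epsilon)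
    then show ?thesis by simp
  qed (use D0.dual_outside[OF \<Phi>'] in simp)
qed

lemma I_op_inj:
  assumes "\<Phi> \<in> bidual sX E\<^sub>0 NE" "\<Psi> \<in> bidual sX E\<^sub>0 NE" "I \<Phi> = I \<Psi>"
  shows "\<Phi> = \<Psi>"
proof -
  have "\<Phi> - \<Psi> = 0"
  proof (rule bidual_eq_zeroI)
    show "\<Phi> - \<Psi> \<in> bidual sX E\<^sub>0 NE" using assms(1,2) by (rule DD0.diff_V)
    show "(\<Phi> - \<Psi>) (J f) = 0" if "f \<in> dual sX UNIV norm" for f
      using I_op_apply[OF assms(1) that] I_op_apply[OF assms(2) that] assms(3) by simp
  qed
  then show ?thesis by simp
qed

text \<open>
  For \<open>T\<close> in the family and \<open>g\<close> of norm at most one on \<open>Y\<close>, the functional \<open>g \<circ> T\<close> has norm at most one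
  with respect to the norm of \<open>E\<^sub>0\<close>. Choosing \<open>g\<close> norming for \<open>T (I \<Phi>)\<close> bounds the norm of this vector.
\<close>

lemma I_op_bound:
  assumes \<Phi>: "\<Phi> \<in> bidual sX E\<^sub>0 NE"
  shows "I \<Phi> \<in> E" "NE (I \<Phi>) \<le> bidual_norm sX E\<^sub>0 NE \<Phi>"
proof -
  note \<Phi>' = bidual_dual[OF \<Phi>]
  have M: "0 \<le> bidual_norm sX E\<^sub>0 NE \<Phi>" using \<Phi> by (rule DD0.N_nonneg)
  have bound: "norm (blinfun_apply T (I \<Phi>)) \<le> bidual_norm sX E\<^sub>0 NE \<Phi>" if T: "T \<in> L" for T
  proof -
    obtain g where g: "g \<in> dual sY UNIV norm" "\<And>y. norm (g y) \<le> norm y"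
      "g (blinfun_apply T (I \<Phi>)) = of_real (norm (blinfun_apply T (I \<Phi>)))"
      by (rule norming_functional[OF sY]) blast
    let ?f = "\<lambda>x. g (blinfun_apply T x)"
    have f: "?f \<in> dual sX UNIV norm"
    proof (rule XN.dualI[where C = "norm T"])
      show "norm (?f x) \<le> norm T * norm x" for x
        using order_trans[OF g(2) norm_blinfun] .
    qed (auto simp: blinfun.add_right YN.dual_add[OF g(1)] apply_scale[OF T] YN.dual_scale[OF g(1)])
    have Jf: "dual_norm E\<^sub>0 NE (J ?f) \<le> 1"
    proof (rule E0N.dual_norm_leI)
      show "norm (J ?f x) \<le> 1 * NE x" if "x \<in> E\<^sub>0" for x
        using order_trans[OF g(2) apply_le_NE[OF _ T]] that E0_subset by (auto simp: J_op_apply)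
    qed simp
    have "norm (blinfun_apply T (I \<Phi>)) = norm (?f (I \<Phi>))" using g(3) by simp
    also have "\<dots> = norm (\<Phi> (J ?f))" using I_op_apply[OF \<Phi> f] by simp
    also have "\<dots> \<le> bidual_norm sX E\<^sub>0 NE \<Phi> * dual_norm E\<^sub>0 NE (J ?f)"
      unfolding bidual_norm_def by (rule D0.norm_le_dual_norm[OF \<Phi>' J_op_in_dual[OF f]])
    also have "\<dots> \<le> bidual_norm sX E\<^sub>0 NE \<Phi> * 1" using Jf M by (rule mult_left_mono)
    finally show ?thesis by simp
  qed
  show "I \<Phi> \<in> E" using bound by (rule E_I)
  show "NE (I \<Phi>) \<le> bidual_norm sX E\<^sub>0 NE \<Phi>" using bound M by (rule NE_leI)
qed

text \<open>
  The density hypothesis, rescaled from the unit ball. A vector of norm zero is zero by injectivity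
  of the evaluation.
\<close>

lemma approximating_sequence:
  assumes x: "x \<in> E"
  obtains u where "\<And>n. u n \<in> E\<^sub>0" "\<And>n. NE (u n) \<le> NE x" "u \<longlonglongrightarrow> x"
proof (cases "NE x = 0")
  case True
  then have "x = 0" using NE_definite x by blast
  then show ?thesis using that[of "\<lambda>_. 0"] by simp
next
  case False
  then have pos: "NE x > 0" using NE_nonneg[OF x] by simp
  define r where "r = NE x"
  have "(1 / r) *\<^sub>R x = sX (of_real (1 / r)) x" by (rule X.scale_of_real[symmetric])
  then have "(1 / r) *\<^sub>R x \<in> unit_ball E NE"
    using x pos by (simp add: unit_ball_def EN.N_scale EN.scale_V r_def norm_divide)
  then have "(1 / r) *\<^sub>R x \<in> closure (unit_ball E\<^sub>0 NE)" using dense by blast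
  then obtain v where v: "\<And>n. v n \<in> unit_ball E\<^sub>0 NE" "v \<longlonglongrightarrow> (1 / r) *\<^sub>R x"
    unfolding closure_sequential by blast
  show ?thesis
  proof (rule that[of "\<lambda>n. r *\<^sub>R v n"])
    have rv: "r *\<^sub>R v n = sX (of_real r) (v n)" for n by (rule X.scale_of_real[symmetric])
    show "r *\<^sub>R v n \<in> E\<^sub>0" for n using v(1) unfolding rv by (auto simp: unit_ball_def)
    show "NE (r *\<^sub>R v n) \<le> NE x" for n
      unfolding rv using v(1)[of n] pos by (simp add: E0N.N_scale unit_ball_def r_def)
    have "(\<lambda>n. r *\<^sub>R v n) \<longlonglongrightarrow> r *\<^sub>R ((1 / r) *\<^sub>R x)" by (intro tendsto_intros v(2))
    then show "(\<lambda>n. r *\<^sub>R v n) \<longlonglongrightarrow> x" using pos by (simp add: r_def)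
  qed
qed

lemma dual_tendsto:
  assumes f: "f \<in> dual sX UNIV norm" and u: "u \<longlonglongrightarrow> x"
  shows "(\<lambda>n. f (u n)) \<longlonglongrightarrow> f x"
proof -
  have "(\<lambda>n. f (u n) - f x) \<longlonglongrightarrow> 0"
  proof (rule Lim_null_comparison)
    show "\<forall>\<^sub>F n in sequentially. norm (f (u n) - f x) \<le> dual_norm UNIV norm f * norm (u n - x)"
      using XN.norm_le_dual_norm[OF f] XN.dual_diff[OF f] by (intro always_eventually) (metis UNIV_I)
    show "(\<lambda>n. dual_norm UNIV norm f * norm (u n - x)) \<longlonglongrightarrow> 0"
      using u by (intro tendsto_mult_right_zero) (simp add: LIM_zero tendsto_norm_zero)
  qed
  then show ?thesis by (simp add: LIM_zero_iff)
qed

text \<open>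
  Up to an error \<open>d * r\<close> uniform in \<open>n\<close>, the functional \<open>\<phi>\<close> agrees on the sequence with some \<open>f\<close> that is
  continuous for the norm of \<open>X\<close>, in which the sequence converges.
\<close>

lemma E0_dual_convergent:
  assumes u: "\<And>n. u n \<in> E\<^sub>0" "\<And>n. NE (u n) \<le> r" "u \<longlonglongrightarrow> x" and \<phi>: "\<phi> \<in> dual sX E\<^sub>0 NE"
  shows "convergent (\<lambda>n. \<phi> (u n))"
proof (rule Cauchy_scalar_convergent, rule metric_CauchyI)
  fix e :: real assume e: "e > 0"
  have r: "0 \<le> r" using order_trans[OF E0N.N_nonneg[OF u(1)] u(2)] .
  define d where "d = e / (3 * (r + 1))"
  have d: "d > 0" "d * r \<le> e / 3" using e r by (auto simp: d_def field_simps)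
  obtain f where f: "f \<in> dual sX UNIV norm" "\<And>x. x \<in> E\<^sub>0 \<Longrightarrow> norm (\<phi> x - f x) \<le> d * NE x"
    by (rule J_op_dense_range[OF \<phi> d(1)]) blast
  have close: "dist (\<phi> (u n)) (f (u n)) \<le> e / 3" for n
  proof -
    have "dist (\<phi> (u n)) (f (u n)) \<le> d * NE (u n)" using f(2)[OF u(1)] by (simp add: dist_norm)
    also have "\<dots> \<le> d * r" using u(2) d(1) by (intro mult_left_mono) auto
    finally show ?thesis using d(2) by simp
  qed
  have "Cauchy (\<lambda>n. f (u n))" using dual_tendsto[OF f(1) u(3)] by (rule LIMSEQ_imp_Cauchy)
  then obtain M where M: "\<And>m n. m \<ge> M \<Longrightarrow> n \<ge> M \<Longrightarrow> dist (f (u m)) (f (u n)) < e / 3"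
    using metric_CauchyD[of "\<lambda>n. f (u n)" "e / 3"] e by auto
  have "dist (\<phi> (u m)) (\<phi> (u n)) < e" if "m \<ge> M" "n \<ge> M" for m n
    using close[of m] close[of n] M[OF that]
      dist_triangle[of "\<phi> (u m)" "\<phi> (u n)" "f (u m)"] dist_triangle[of "f (u m)" "\<phi> (u n)" "f (u n)"]
      dist_commute[of "\<phi> (u n)" "f (u n)"] by linarith
  then show "\<exists>M. \<forall>m\<ge>M. \<forall>n\<ge>M. dist (\<phi> (u m)) (\<phi> (u n)) < e" by blast
qed

text \<open>
  \<open>\<Phi>\<close> is the pointwise limit on the dual of \<open>E\<^sub>0\<close> of the evaluations at an approximating sequence, so it
  inherits their norm bound.
\<close>

lemma exists_bidual_preimage:
  assumes x: "x \<in> E"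
  obtains \<Phi> where "\<Phi> \<in> bidual sX E\<^sub>0 NE" "I \<Phi> = x" "bidual_norm sX E\<^sub>0 NE \<Phi> \<le> NE x"
proof -
  obtain u where u: "\<And>n. u n \<in> E\<^sub>0" "\<And>n. NE (u n) \<le> NE x" "u \<longlonglongrightarrow> x"
    by (rule approximating_sequence[OF x]) blast
  define \<Phi> where "\<Phi> \<phi> = (if \<phi> \<in> dual sX E\<^sub>0 NE then lim (\<lambda>n. \<phi> (u n)) else 0)" for \<phi>
  have lim: "(\<lambda>n. \<phi> (u n)) \<longlonglongrightarrow> \<Phi> \<phi>" if "\<phi> \<in> dual sX E\<^sub>0 NE" for \<phi>
    using E0_dual_convergent[OF u that] that by (simp add: \<Phi>_def convergent_LIMSEQ_iff)
  have bound: "norm (\<Phi> \<phi>) \<le> NE x * dual_norm E\<^sub>0 NE \<phi>" if \<phi>: "\<phi> \<in> dual sX E\<^sub>0 NE" for \<phi>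
  proof (rule LIMSEQ_le_const2[OF tendsto_norm[OF lim[OF \<phi>]]])
    have "norm (\<phi> (u n)) \<le> NE x * dual_norm E\<^sub>0 NE \<phi>" for n
    proof -
      have "norm (\<phi> (u n)) \<le> dual_norm E\<^sub>0 NE \<phi> * NE (u n)" using \<phi> u(1) by (rule E0N.norm_le_dual_norm)
      also have "\<dots> \<le> dual_norm E\<^sub>0 NE \<phi> * NE x"
        using u(2) E0N.dual_norm_nonneg[OF \<phi>] by (rule mult_left_mono)
      finally show ?thesis by (simp add: mult.commute)
    qed
    then show "\<exists>N. \<forall>n\<ge>N. norm (\<phi> (u n)) \<le> NE x * dual_norm E\<^sub>0 NE \<phi>" by blast
  qed
  show thesis
  proof (rule that)
    show \<Phi>: "\<Phi> \<in> bidual sX E\<^sub>0 NE"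
      unfolding bidual_def
    proof (rule D0.dualI[OF _ _ bound])
      show "\<Phi> (\<phi> + \<theta>) = \<Phi> \<phi> + \<Phi> \<theta>" if "\<phi> \<in> dual sX E\<^sub>0 NE" "\<theta> \<in> dual sX E\<^sub>0 NE" for \<phi> \<theta>
        using lim[OF D0.add_V[OF that]] tendsto_add[OF lim[OF that(1)] lim[OF that(2)]]
        by (auto intro: LIMSEQ_unique)
      show "\<Phi> (fun_scale c \<phi>) = c * \<Phi> \<phi>" if "\<phi> \<in> dual sX E\<^sub>0 NE" for c \<phi>
        using lim[OF D0.scale_V[OF that, of c]] tendsto_mult_left[OF lim[OF that], of c]
        by (auto simp: fun_scale_def intro: LIMSEQ_unique)
    qed (simp_all add: \<Phi>_def)
    show "I \<Phi> = x"
    proof (rule I_op_eqI[OF \<Phi>])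
      fix f :: "'x \<Rightarrow> 'k" assume f: "f \<in> dual sX UNIV norm"
      have "(\<lambda>n. J f (u n)) \<longlonglongrightarrow> f x" using dual_tendsto[OF f u(3)] u(1) by (simp add: J_op_apply)
      then show "\<Phi> (J f) = f x" using lim[OF J_op_in_dual[OF f]] by (rule LIMSEQ_unique[rotated])
    qed
    show "bidual_norm sX E\<^sub>0 NE \<Phi> \<le> NE x"
      unfolding bidual_norm_def using NE_nonneg[OF x] bound by (rule D0.dual_norm_leI)
  qed
qed

lemma I_op_linear_isometry_onto:
  "linear_isometry_onto fun_scale (bidual sX E\<^sub>0 NE) (bidual_norm sX E\<^sub>0 NE) sX E NE I"
  unfolding linear_isometry_onto_def
proof (intro conjI ballI allI)
  fix \<Phi> \<Psi> assume \<Phi>: "\<Phi> \<in> bidual sX E\<^sub>0 NE" and \<Psi>: "\<Psi> \<in> bidual sX E\<^sub>0 NE"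
  show "I (\<Phi> + \<Psi>) = I \<Phi> + I \<Psi>"
    by (rule I_op_eqI[OF DD0.add_V[OF \<Phi> \<Psi>]])
      (simp add: XN.dual_add I_op_apply[OF \<Phi>] I_op_apply[OF \<Psi>])
next
  fix c \<Phi> assume \<Phi>: "\<Phi> \<in> bidual sX E\<^sub>0 NE"
  show "I (fun_scale c \<Phi>) = sX c (I \<Phi>)"
    by (rule I_op_eqI[OF DD0.scale_V[OF \<Phi>]])
      (simp add: XN.dual_scale I_op_apply[OF \<Phi>] fun_scale_def)
next
  fix \<Phi> assume \<Phi>: "\<Phi> \<in> bidual sX E\<^sub>0 NE"
  obtain \<Psi> where "\<Psi> \<in> bidual sX E\<^sub>0 NE" "I \<Psi> = I \<Phi>" "bidual_norm sX E\<^sub>0 NE \<Psi> \<le> NE (I \<Phi>)"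
    by (rule exists_bidual_preimage[OF I_op_bound(1)[OF \<Phi>]])
  moreover from this have "\<Psi> = \<Phi>" using \<Phi> by (intro I_op_inj)
  ultimately show "NE (I \<Phi>) = bidual_norm sX E\<^sub>0 NE \<Phi>"
    using I_op_bound(2)[OF \<Phi>] by simp
next
  show "I ` bidual sX E\<^sub>0 NE = E"
  proof (intro equalityI subsetI)
    fix x assume "x \<in> E"
    then obtain \<Phi> where "\<Phi> \<in> bidual sX E\<^sub>0 NE" "I \<Phi> = x" by (rule exists_bidual_preimage)
    then show "x \<in> I ` bidual sX E\<^sub>0 NE" by blast
  qed (use I_op_bound(1) in blast)
qed

end

theorem theorem3p1:
  fixes sX :: "'k::real_or_complex_field \<Rightarrow> 'x::banach \<Rightarrow> 'x"
    and sY :: "'k \<Rightarrow> 'y::banach \<Rightarrow> 'y"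
    and L :: "('x \<Rightarrow>\<^sub>L 'y) set"
    and \<tau> :: "('x \<Rightarrow>\<^sub>L 'y) topology"
  assumes "normed_scaling sX" and "normed_scaling sY"
    and "reflexive sX UNIV norm"
    and "L \<subseteq> bounded_operators sX sY"
    and "topspace \<tau> = L"
    and "locally_compact_space \<tau>" and "Hausdorff_space \<tau>"
    and "finer_than \<tau> (subtopology strong_operator_topology L)"
    and "inj_on (evaluation L) (E_space L)"
    and "closedin (mtopology_of (cfunspace \<tau> euclidean_metric)) (evaluation L ` E_space L)"
    and "unit_ball (E_space L) (E_norm L) \<subseteq> closure (unit_ball (E0_space L \<tau>) (E_norm L))"
  shows "linear_isometry_onto
           fun_scale
           (bidual sX (E0_space L \<tau>) (E_norm L))
           (bidual_norm sX (E0_space L \<tau>) (E_norm L))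
           sX (E_space L) (E_norm L)
           (I_op sX L \<tau>)"
proof -
  interpret biduality_setting sX sY L \<tau>
    using assms
    by (intro biduality_setting.intro complete_operator_family.intro operator_family.intro
        complete_operator_family_axioms.intro biduality_setting_axioms.intro)
  show ?thesis by (rule I_op_linear_isometry_onto)
qed

end
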